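(* Let $Z_n$ be the number of protected (i.e. two-protected) nodes in a random ternary search tree (an $m$-ary search tree with $m=3$) with $n$ keys. Then, as $n\to\infty$, $$\frac{Z_n-\frac{57}{700}n}{\sqrt{n}}\stackrel{d}{\longrightarrow}\mathcal{N}\left(0,\frac{1692302314867}{43692253605000}\right).$$
   Context: Here $\stackrel{d}{\longrightarrow}$ denotes convergence in distribution and $\mathcal{N}(\mu,\sigma^2)$ is the normal distribution with mean $\mu$ and variance $\sigma^2$. Random $m$-ary search tree ($m\ge2$). It is constructed recursively from a sequence of $n$ keys which are i.i.d. uniform random numbers in $[0,1]$ (equivalently, a uniformly random permutation of $\{1,\dots,n\}$; only the order of the keys matters). Each node may contain up to $m-1$ keys. One starts with an empty root. The first $m-1$ keys are put in the root, in increasing order from left to right; they divide the set of real numbers into $m$ intervals $J_1,\dots,J_m$. When the root is full (contains $m-1$ keys) it gets $m$ children that are initially empty, and each further key is passed to one of the children: a key in $J_i$ is passed to the $i$-th child. The procedure repeats recursively in the subtrees until all keys are added. Nodes containing at least one key are called internal; empty nodes are called external. The $m$-ary search tree is regarded as consisting only of its internal nodes; external nodes are not really part of the tree. A leaf is an internal node that has no internal children (it may have external children). A node is protected (two-protected) if it is an internal node that is not a leaf and none of its children is a leaf (it may have external nodes as children). *)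

theory Defs
  imports "HOL-Probability.Probability"
begin

text \<open>
  A node that is not full has an empty list of children; a full node has exactly \<open>m\<close>
  children, each of which may be external (an empty node). The key list is increasing.
\<close>

datatype 'a search_tree = External | Node "'a list" "'a search_tree list"

text \<open>
  The keys \<open>ks\<close> of a full node split the line into the intervals \<open>J\<^sub>0, \<dots>, J\<^sub>m\<^sub>-\<^sub>1\<close>, numbered from
  left to right and from 0; the interval containing \<open>x\<close> has as its number the number of
  keys of the node below \<open>x\<close>. (A key equal to a key of the node goes to the left of it; for
  i.i.d. uniform keys this has probability 0.)
\<close>

definition interval_index :: "'a::linorder list \<Rightarrow> 'a \<Rightarrow> nat" where
  "interval_index ks x = length (filter (\<lambda>k. k < x) ks)"

text \<open>
  The \<open>m\<close>-ary search tree of a sequence of keys, given in order of arrival. The keys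
  passed to a child keep their order of arrival. The notion is only meant for \<open>m \<ge> 2\<close>; for
  \<open>m < 2\<close> the value is arbitrary, so that the recursion terminates.
\<close>

function mary_search_tree :: "nat \<Rightarrow> 'a::linorder list \<Rightarrow> 'a search_tree" where
  "mary_search_tree m xs =
     (if xs = [] \<or> m < 2 then External
      else if length xs < m - 1 then Node (sort xs) []
      else let ks = sort (take (m - 1) xs)
           in Node ks
                (map (\<lambda>i. mary_search_tree m
                            (filter (\<lambda>x. interval_index ks x = i) (drop (m - 1) xs)))
                   [0..<m]))"
  by auto
termination
proof (relation "Wellfounded.measure (\<lambda>(m, xs). length xs)", goal_cases)
  case 1
  show ?case by simp
next
  case (2 m xs ks i)
  have "length (filter (\<lambda>x. interval_index ks x = i) (drop (m - 1) xs)) \<le> length xs - (m - 1)"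
    by (metis length_drop length_filter_le)
  also have "\<dots> < length xs"
    using 2 by (cases xs) auto
  finally show ?case by simp
qed

declare mary_search_tree.simps [simp del]

fun children :: "'a search_tree \<Rightarrow> 'a search_tree list" where
  "children External = []"
| "children (Node ks ts) = ts"

definition internal :: "'a search_tree \<Rightarrow> bool" where
  "internal t \<longleftrightarrow> t \<noteq> External"

text \<open>The following predicates describe the root of \<open>t\<close> within its fringe subtree \<open>t\<close>.\<close>

definition leaf :: "'a search_tree \<Rightarrow> bool" where
  "leaf t \<longleftrightarrow> internal t \<and> (\<forall>c \<in> set (children t). \<not> internal c)"

definition protected_node :: "'a search_tree \<Rightarrow> bool" where
  "protected_node t \<longleftrightarrow> internal t \<and> \<not> leaf t \<and> (\<forall>c \<in> set (children t). \<not> leaf c)"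

fun num_protected :: "'a search_tree \<Rightarrow> nat" where
  "num_protected External = 0"
| "num_protected (Node ks ts) =
     (if protected_node (Node ks ts) then 1 else 0) + sum_list (map num_protected ts)"

end

theory Submission
  imports Defs "HOL-Real_Asymp.Real_Asymp"
begin

text \<open>
  Let \<open>\<phi>\<^sub>n\<close> be the characteristic function of the number of protected nodes in the tree of \<open>n\<close>
  keys. The first two keys of a uniformly random order split the other \<open>N = n - 2\<close> keys into
  three groups whose sizes \<open>(i, j, k)\<close> are uniform among all triples with \<open>i + j + k = N\<close>, and
  given the sizes the groups are independent and each again in uniformly random order. The
  root is protected iff no group has size 1 or 2 (those are the sizes of a leaf). Hence, for
  \<open>n \<ge> 3\<close>, \<open>\<phi>\<^sub>n(t)\<close> is the average of \<open>e\<^bsup>it\<tau>(i,j,k)\<^esup> \<phi>\<^sub>i(t) \<phi>\<^sub>j(t) \<phi>\<^sub>k(t)\<close> over the triples, where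
  \<open>\<tau> \<in> {0, 1}\<close> is the indicator of that event (\<open>prot_char_rec\<close>).

  The central limit theorem follows from this recursion by comparing \<open>\<phi>\<^sub>n(t)\<close> with the Gaussian
  \<open>\<psi>\<^sub>n(t) = e\<^bsup>it m\<^sub>n - t\<^sup>2 v\<^sub>n / 2\<^esup>\<close>, where \<open>m\<^sub>n\<close> and \<open>v\<^sub>n\<close> stand for the mean and the variance. Both have modulus
  at most 1, so \<open>\<phi>\<^sub>i \<phi>\<^sub>j \<phi>\<^sub>k\<close> and \<open>\<psi>\<^sub>i \<psi>\<^sub>j \<psi>\<^sub>k\<close> differ by at most the sum of the three errors. The
  Gaussians satisfy the recursion up to the factor \<open>e\<^bsup>itb - t\<^sup>2h/2\<^esup>\<close> with
  \<open>b = \<tau> + m\<^sub>i + m\<^sub>j + m\<^sub>k - m\<^sub>n\<close> and \<open>h = v\<^sub>i + v\<^sub>j + v\<^sub>k - v\<^sub>n\<close>. As \<open>m\<close> and \<open>v\<close> are almost linear, \<open>b\<close> and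
  \<open>h\<close> are bounded; by the recursions for mean and variance the average of \<open>b\<close> and that of
  \<open>b\<^sup>2 + h\<close> are 0, which are exactly the terms of order \<open>t\<close> and \<open>t\<^sup>2\<close>. So each step costs
  \<open>O(|t|\<^sup>3)\<close>, and induction gives \<open>|\<phi>\<^sub>n(t) - \<psi>\<^sub>n(t)| \<le> C n |t|\<^sup>3\<close> (\<open>gaussian_approximation\<close>). At
  \<open>t = s / \<surd>n\<close> this tends to 0, and Levy's continuity theorem concludes.

  The remaining point is to know \<open>m\<close> and \<open>v\<close> well enough. The averaging over triples is a
  product of power series, so the recursions for the first two moments are linear second
  order differential equations of Euler type in \<open>1 - X\<close>. With \<open>D = 1 - X\<close> and \<open>L = - log D\<close> their
  solutions are polynomials in \<open>D\<close> and \<open>L\<close>, plus a multiple of \<open>D\<^sup>-\<^sup>2\<close> that carries the linear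
  growth; logarithms appear since \<open>D\<^sup>3\<close> solves the homogeneous equation. Such polynomials have
  bounded coefficients, which is all that is needed besides the two growth rates. The
  explicit solutions are merely verified; in particular it need not be shown that \<open>m\<close> and
  \<open>v\<close> are the moments, since the comparison only uses their recursions.
\<close>

unbundle no vec_syntax
unbundle fps_syntax

section \<open>Ternary search trees of distinct keys\<close>

lemma sort_map_strict_mono:
  assumes "strict_mono_on (set xs) g"
  shows "sort (map g xs) = map g (sort xs)"
proof (rule properties_for_sort)
  show "mset (map g (sort xs)) = mset (map g xs)" by simp
  have "sorted_wrt (\<lambda>x y. x \<in> set xs \<and> y \<in> set xs \<and> x \<le> y) (sort xs)"
    by (rule sorted_wrt_mono_rel[OF _ sorted_sort]) auto
  then have "sorted_wrt (\<lambda>x y. g x \<le> g y) (sort xs)"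
    by (rule sorted_wrt_mono_rel[rotated])
       (use assms in \<open>auto simp: strict_mono_on_leD\<close>)
  then show "sorted (map g (sort xs))"
    by (simp add: sorted_wrt_map)
qed

lemma interval_index_map_strict_mono:
  assumes "strict_mono_on A g" "set ks \<subseteq> A" "x \<in> A"
  shows "interval_index (map g ks) (g x) = interval_index ks x"
proof -
  have "filter (\<lambda>k. g k < g x) ks = filter (\<lambda>k. k < x) ks"
    using assms by (intro filter_cong refl) (auto simp: strict_mono_on_less)
  then show ?thesis
    by (simp add: interval_index_def filter_map o_def)
qed

text \<open>
  The tree only depends on the relative order of the keys.
\<close>
lemma mary_search_tree_map:
  assumes "strict_mono_on (set xs) g"
  shows "mary_search_tree m (map g xs) = map_search_tree g (mary_search_tree m xs)"
  using assms
proof (induction m xs rule: mary_search_tree.induct)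
  case (1 m xs)
  consider "xs = [] \<or> m < 2" | "\<not> (xs = [] \<or> m < 2)" "length xs < m - 1"
    | "\<not> (xs = [] \<or> m < 2)" "\<not> length xs < m - 1" by blast
  then show ?case
  proof cases
    case 1
    then show ?thesis
      by (subst (1 2) mary_search_tree.simps) auto
  next
    case 2
    then show ?thesis
      by (subst (1 2) mary_search_tree.simps) (auto simp: sort_map_strict_mono "1.prems")
  next
    case 3
    let ?ks = "sort (take (m - 1) xs)"
    have sub: "set (take (m - 1) xs) \<subseteq> set xs" "set (drop (m - 1) xs) \<subseteq> set xs"
      by (rule set_take_subset, rule set_drop_subset)
    have ks: "sort (take (m - 1) (map g xs)) = map g ?ks"
      unfolding take_map
      by (intro sort_map_strict_mono monotone_on_subset[OF "1.prems"] sub)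
    have f: "filter (\<lambda>x. interval_index (map g ?ks) x = i) (drop (m - 1) (map g xs))
        = map g (filter (\<lambda>x. interval_index ?ks x = i) (drop (m - 1) xs))" for i
    proof -
      have "filter (\<lambda>x. interval_index (map g ?ks) (g x) = i) (drop (m - 1) xs) =
          filter (\<lambda>x. interval_index ?ks x = i) (drop (m - 1) xs)"
      proof (intro filter_cong refl)
        fix x assume "x \<in> set (drop (m - 1) xs)"
        then have "interval_index (map g ?ks) (g x) = interval_index ?ks x"
          using sub by (intro interval_index_map_strict_mono[OF "1.prems"]) auto
        then show "(interval_index (map g ?ks) (g x) = i) = (interval_index ?ks x = i)"
          by simp
      qed
      then show ?thesis by (simp add: drop_map filter_map o_def)
    qed
    have IH: "mary_search_tree m (map g (filter (\<lambda>x. interval_index ?ks x = i) (drop (m - 1) xs)))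
        = map_search_tree g (mary_search_tree m (filter (\<lambda>x. interval_index ?ks x = i) (drop (m - 1) xs)))"
      if "i \<in> set [0..<m]" for i
      using 3 that sub
      by (intro "1.IH"[OF _ _ refl] monotone_on_subset[OF "1.prems"]) auto
    have "mary_search_tree m (map g xs) = Node (map g ?ks)
       (map (\<lambda>i. mary_search_tree m (map g (filter (\<lambda>x. interval_index ?ks x = i) (drop (m - 1) xs)))) [0..<m])"
      using 3 by (subst mary_search_tree.simps) (simp add: Let_def ks f del: One_nat_def)
    also have "\<dots> = Node (map g ?ks)
       (map (\<lambda>i. map_search_tree g (mary_search_tree m (filter (\<lambda>x. interval_index ?ks x = i) (drop (m - 1) xs)))) [0..<m])"
      using IH by simp
    also have "\<dots> = map_search_tree g (mary_search_tree m xs)"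
      using 3 by (subst (2) mary_search_tree.simps) (simp add: Let_def del: One_nat_def)
    finally show ?thesis .
  qed
qed

lemma internal_map_search_tree [simp]: "internal (map_search_tree g t) = internal t"
  by (cases t) (simp_all add: internal_def)

lemma children_map_search_tree: "children (map_search_tree g t) = map (map_search_tree g) (children t)"
  by (cases t) simp_all

lemma leaf_map_search_tree [simp]: "leaf (map_search_tree g t) = leaf t"
  by (simp add: leaf_def children_map_search_tree)

lemma protected_node_map_search_tree [simp]: "protected_node (map_search_tree g t) = protected_node t"
  by (simp add: protected_node_def children_map_search_tree)

lemma num_protected_map_search_tree [simp]: "num_protected (map_search_tree g t) = num_protected t"
proof (induction t)
  case (Node ks ts)
  have "protected_node (Node (map g ks) (map (map_search_tree g) ts)) = protected_node (Node ks ts)"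
    using protected_node_map_search_tree[of g "Node ks ts"] by simp
  moreover have "map num_protected (map (map_search_tree g) ts) = map num_protected ts"
    using Node by simp
  ultimately show ?case by (simp only: search_tree.map num_protected.simps)
qed simp

definition prot_count :: "'a::linorder list \<Rightarrow> nat" where
  "prot_count xs = num_protected (mary_search_tree 3 xs)"

lemma prot_count_map:
  "strict_mono_on (set xs) g \<Longrightarrow> prot_count (map g xs) = prot_count xs"
  by (simp add: prot_count_def mary_search_tree_map)

lemma mary_search_tree_3_Nil: "mary_search_tree 3 [] = External"
  by (simp add: mary_search_tree.simps)

lemma mary_search_tree_3_single: "mary_search_tree 3 [x] = Node [x] []"
  by (simp add: mary_search_tree.simps)

lemma mary_search_tree_3_Cons_Cons:
  fixes x y :: "'a::linorder"
  assumes "x \<noteq> y"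
  defines "a \<equiv> min x y" and "b \<equiv> max x y"
  shows "mary_search_tree 3 (x # y # zs) = Node [a, b]
     [mary_search_tree 3 (filter (\<lambda>z. z \<le> a) zs),
      mary_search_tree 3 (filter (\<lambda>z. a < z \<and> z \<le> b) zs),
      mary_search_tree 3 (filter (\<lambda>z. b < z) zs)]"
proof -
  have ab: "a < b" using assms by (auto simp: min_def max_def)
  have ks: "sort (take (3 - 1) (x # y # zs)) = [a, b]"
    using assms by (auto simp: min_def max_def)
  have idx: "interval_index [a, b] z = 0 \<longleftrightarrow> z \<le> a"
     "interval_index [a, b] z = 1 \<longleftrightarrow> a < z \<and> z \<le> b"
     "interval_index [a, b] z = 2 \<longleftrightarrow> b < z" for z
    using ab by (auto simp: interval_index_def)
  have upt: "[0..<3] = [0, 1, 2]" by (simp add: upt_rec)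
  have "drop (3 - 1) (x # y # zs) = zs" by simp
  then show ?thesis
    by (subst mary_search_tree.simps) (simp only: ks Let_def upt list.map idx, simp)
qed

lemma mary_search_tree_3_External_iff: "mary_search_tree 3 xs = External \<longleftrightarrow> xs = []"
  by (subst mary_search_tree.simps) (simp add: Let_def)

lemma leaf_External: "\<not> leaf External"
  by (simp add: leaf_def internal_def)

text \<open>
  As soon as there is a third key, one of the three groups is not empty, so the root has an
  internal child.
\<close>
lemma leaf_mary_search_tree_3:
  assumes "distinct xs"
  shows "leaf (mary_search_tree 3 xs) \<longleftrightarrow> length xs \<in> {1, 2}"
proof -
  consider "xs = []" | x where "xs = [x]" | x y zs where "xs = x # y # zs"
    by (metis list.exhaust)
  then show ?thesis
  proof cases
    case 1 then show ?thesis by (simp add: mary_search_tree_3_Nil leaf_External)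
  next
    case 2 then show ?thesis by (simp add: mary_search_tree_3_single leaf_def internal_def)
  next
    case 3
    with assms have "x \<noteq> y" by simp
    have "(\<forall>z\<in>set zs. \<not> z \<le> min x y) \<and> (\<forall>z\<in>set zs. \<not> (min x y < z \<and> z \<le> max x y))
        \<and> (\<forall>z\<in>set zs. \<not> max x y < z) \<longleftrightarrow> set zs = {}"
      by (metis equals0I ex_in_conv not_le)
    then show ?thesis
      unfolding 3 mary_search_tree_3_Cons_Cons[OF \<open>x \<noteq> y\<close>]
      by (auto simp: leaf_def internal_def mary_search_tree_3_External_iff filter_empty_conv)
  qed
qed

lemma prot_count_short: "distinct xs \<Longrightarrow> length xs < 3 \<Longrightarrow> prot_count xs = 0"
proof -
  assume *: "distinct xs" "length xs < 3"
  consider "xs = []" | x where "xs = [x]" | x y where "xs = [x, y]"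
    using *(2) by (cases xs; cases "tl xs"; cases "tl (tl xs)") auto
  then show ?thesis
  proof cases
    case 3
    with * have "x \<noteq> y" by simp
    show ?thesis
      using leaf_mary_search_tree_3[OF *(1)]
      unfolding 3 prot_count_def mary_search_tree_3_Cons_Cons[OF \<open>x \<noteq> y\<close>]
      by (simp add: protected_node_def mary_search_tree_3_Nil)
  qed (simp_all add: prot_count_def mary_search_tree_3_Nil mary_search_tree_3_single protected_node_def leaf_def)
qed

text \<open>
  The case of exactly two keys is excluded here: its root has no child that is a leaf, but it
  is a leaf itself and therefore not protected.
\<close>
lemma prot_count_Cons_Cons:
  fixes x y :: "'a::linorder"
  defines "a \<equiv> min x y" and "b \<equiv> max x y"
  defines "l0 \<equiv> \<lambda>zs. filter (\<lambda>z. z \<le> a) zs" and "l1 \<equiv> \<lambda>zs. filter (\<lambda>z. a < z \<and> z \<le> b) zs"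
    and "l2 \<equiv> \<lambda>zs. filter (\<lambda>z. b < z) zs"
  assumes d: "distinct (x # y # zs)" and "zs \<noteq> []"
  shows "prot_count (x # y # zs) =
    (if {length (l0 zs), length (l1 zs), length (l2 zs)} \<inter> {1, 2} = {} then 1 else 0)
    + prot_count (l0 zs) + prot_count (l1 zs) + prot_count (l2 zs)"
proof -
  have "x \<noteq> y" using d by simp
  note tree = mary_search_tree_3_Cons_Cons[OF this, of zs, folded a_def b_def,
      folded l0_def l1_def l2_def]
  have dl: "distinct (l0 zs)" "distinct (l1 zs)" "distinct (l2 zs)"
    using d by (simp_all add: l0_def l1_def l2_def)
  have "\<not> leaf (mary_search_tree 3 (x # y # zs))"
    using leaf_mary_search_tree_3[OF d] \<open>zs \<noteq> []\<close> by simp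
  then have "protected_node (mary_search_tree 3 (x # y # zs)) \<longleftrightarrow>
      {length (l0 zs), length (l1 zs), length (l2 zs)} \<inter> {1, 2} = {}"
    using dl unfolding protected_node_def tree
    by (auto simp: internal_def leaf_mary_search_tree_3)
  then show ?thesis
    by (simp add: prot_count_def tree)
qed

section \<open>Sums over the sizes of the three groups\<close>

definition sum_splits :: "nat \<Rightarrow> (nat \<Rightarrow> nat \<Rightarrow> nat \<Rightarrow> 'b::comm_monoid_add) \<Rightarrow> 'b" where
  "sum_splits N F = (\<Sum>i=0..N. \<Sum>j=0..N-i. F i j (N - i - j))"

definition num_splits :: "nat \<Rightarrow> real" where
  "num_splits N = (real N + 1) * (real N + 2) / 2"

lemma sum_splits_cong:
  assumes "\<And>i j k. i + j + k = N \<Longrightarrow> F i j k = G i j k"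
  shows "sum_splits N F = sum_splits N G"
  unfolding sum_splits_def by (intro sum.cong refl assms) auto

lemma sum_splits_mono:
  fixes F G :: "nat \<Rightarrow> nat \<Rightarrow> nat \<Rightarrow> real"
  assumes "\<And>i j k. i + j + k = N \<Longrightarrow> F i j k \<le> G i j k"
  shows "sum_splits N F \<le> sum_splits N G"
  unfolding sum_splits_def by (intro sum_mono assms) auto

lemma sum_splits_add: "sum_splits N (\<lambda>i j k. F i j k + G i j k) = sum_splits N F + sum_splits N G"
  by (simp add: sum_splits_def sum.distrib)

lemma sum_splits_diff:
  fixes F G :: "nat \<Rightarrow> nat \<Rightarrow> nat \<Rightarrow> 'b::ab_group_add"
  shows "sum_splits N (\<lambda>i j k. F i j k - G i j k) = sum_splits N F - sum_splits N G"
  by (simp add: sum_splits_def sum_subtractf)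

lemma sum_splits_cmult:
  fixes c :: "'b::semiring_0"
  shows "sum_splits N (\<lambda>i j k. c * F i j k) = c * sum_splits N F"
  by (simp add: sum_splits_def sum_distrib_left)

lemma norm_sum_splits_le:
  fixes F :: "nat \<Rightarrow> nat \<Rightarrow> nat \<Rightarrow> 'b::real_normed_vector"
  shows "norm (sum_splits N F) \<le> sum_splits N (\<lambda>i j k. norm (F i j k))"
  unfolding sum_splits_def by (intro order_trans[OF norm_sum] sum_mono) auto

lemma sum_splits_of_real:
  "sum_splits N (\<lambda>i j k. of_real (F i j k) :: 'b::real_algebra_1) = of_real (sum_splits N F)"
  by (simp add: sum_splits_def)

lemma sum_splits_const: "sum_splits N (\<lambda>_ _ _. c) = num_splits N * (c::real)"
proof -
  have "sum_splits N (\<lambda>_ _ _. c) = (\<Sum>i=0..N. real (N - i + 1)) * c"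
    by (simp add: sum_splits_def sum_distrib_right)
  also have "(\<Sum>i=0..N. real (N - i + 1)) = (\<Sum>i=0..N. real (i + 1))"
    by (subst sum.atLeastAtMost_rev) simp
  also have "\<dots> = num_splits N"
    by (induction N) (simp_all add: num_splits_def field_simps)
  finally show ?thesis .
qed

lemma num_splits_pos: "num_splits N > 0"
  by (simp add: num_splits_def)

text \<open>
  This is what turns recursions over splits into differential equations for generating
  functions.
\<close>
lemma sum_splits_fps:
  "sum_splits N (\<lambda>i j k. f $ i * g $ j * h $ k) = (f * g * h :: 'b::comm_semiring_1 fps) $ N"
  by (simp add: sum_splits_def fps_mult_nth mult.assoc sum_distrib_left)

lemma fps_deriv2_nth: "fps_deriv (fps_deriv f) $ N = 2 * num_splits N * f $ (N + 2)"
  by (simp add: num_splits_def field_simps numeral_2_eq_2)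

text \<open>
  Here \<open>x\<close> and \<open>y\<close> are the ranks of the first two keys: the smaller one, \<open>i\<close>, is the size of the
  left group, and \<open>j\<close> ranks lie strictly between the two. The factor 2 counts the two orders in
  which these keys may arrive.
\<close>
lemma sum_off_diagonal:
  fixes G :: "nat \<Rightarrow> nat \<Rightarrow> 'b::comm_semiring_1"
  shows "(\<Sum>x<N+2. \<Sum>y\<in>{..<N+2}-{x}. G (min x y) (max x y)) =
    2 * sum_splits N (\<lambda>i j k. G i (i + j + 1))"
proof -
  let ?n = "N + 2"
  have split: "(\<Sum>y\<in>{..<?n}-{x}. G (min x y) (max x y)) = (\<Sum>y<x. G y x) + (\<Sum>y\<in>{x<..<?n}. G x y)"
    if "x < ?n" for x
  proof -
    have "{..<?n} - {x} = {..<x} \<union> {x<..<?n}" using that by auto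
    then have "(\<Sum>y\<in>{..<?n}-{x}. G (min x y) (max x y)) =
        (\<Sum>y<x. G (min x y) (max x y)) + (\<Sum>y\<in>{x<..<?n}. G (min x y) (max x y))"
      by (simp add: sum.union_disjoint Int_def)
    then show ?thesis by (simp add: min_def max_def)
  qed
  have swap: "(\<Sum>x<?n. \<Sum>y<x. G y x) = (\<Sum>x<?n. \<Sum>y\<in>{x<..<?n}. G x y)"
    unfolding sum.Sigma[OF finite_lessThan ballI[OF finite_lessThan]]
      sum.Sigma[OF finite_lessThan ballI[OF finite_greaterThanLessThan]]
    by (rule sum.reindex_bij_witness[of _ prod.swap prod.swap]) auto
  have inner: "(\<Sum>y\<in>{x<..<?n}. G x y) = (\<Sum>j=0..N-x. G x (x + j + 1))" if "x \<le> N" for x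
    by (rule sum.reindex_bij_witness[of _ "\<lambda>j. x + j + 1" "\<lambda>y. y - x - 1"]) (use that in auto)
  have "{..<?n} = insert (N + 1) {0..N}" "{N + 1<..<?n} = {}" by auto
  then have "(\<Sum>x<?n. \<Sum>y\<in>{x<..<?n}. G x y) = (\<Sum>x=0..N. \<Sum>y\<in>{x<..<?n}. G x y)"
    by simp
  also have "\<dots> = sum_splits N (\<lambda>i j k. G i (i + j + 1))"
    unfolding sum_splits_def by (rule sum.cong[OF refl], rule inner) simp
  finally have one: "(\<Sum>x<?n. \<Sum>y\<in>{x<..<?n}. G x y) = sum_splits N (\<lambda>i j k. G i (i + j + 1))" .
  have "(\<Sum>x<?n. \<Sum>y\<in>{..<?n}-{x}. G (min x y) (max x y)) =
      (\<Sum>x<?n. (\<Sum>y<x. G y x) + (\<Sum>y\<in>{x<..<?n}. G x y))"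
    by (intro sum.cong refl split) simp
  also have "\<dots> = 2 * (\<Sum>x<?n. \<Sum>y\<in>{x<..<?n}. G x y)"
    by (simp only: sum.distrib swap mult_2)
  finally show ?thesis by (simp only: one)
qed

text \<open>
  For \<open>i + j + k > 0\<close> this is the number of protected nodes that the root adds to those of its
  subtrees of sizes \<open>i\<close>, \<open>j\<close>, \<open>k\<close>; 1 and 2 are the sizes of a leaf.
\<close>
definition split_toll :: "nat \<Rightarrow> nat \<Rightarrow> nat \<Rightarrow> real" where
  "split_toll i j k = (if {i, j, k} \<inter> {1, 2} = {} then 1 else 0)"

section \<open>The recursion for random permutations\<close>

abbreviation random_perm :: "'a set \<Rightarrow> 'a list pmf" where
  "random_perm S \<equiv> pmf_of_set (permutations_of_set S)"

lemma set_random_perm: "finite S \<Longrightarrow> set_pmf (random_perm S) = permutations_of_set S"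
  by (simp add: set_pmf_of_set)

lemma expectation_random_perm_cong:
  fixes f g :: "'a list \<Rightarrow> 'b::{banach, second_countable_topology}"
  assumes "finite S" "\<And>xs. xs \<in> permutations_of_set S \<Longrightarrow> f xs = g xs"
  shows "measure_pmf.expectation (random_perm S) f = measure_pmf.expectation (random_perm S) g"
  using assms by (intro integral_cong_AE) (auto simp: AE_measure_pmf_iff set_random_perm)

lemma finite_set_random_perm: "finite S \<Longrightarrow> finite (set_pmf (random_perm S))"
  by (simp add: set_random_perm)

lemma expectation_random_perm_sum:
  fixes f :: "'a list \<Rightarrow> 'b::{banach, second_countable_topology}"
  assumes "finite S"
  shows "measure_pmf.expectation (random_perm S) f = (\<Sum>\<sigma>\<in>permutations_of_set S. f \<sigma> /\<^sub>R fact (card S))"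
  using assms
  by (subst integral_measure_pmf[of "permutations_of_set S"])
     (auto simp: set_random_perm pmf_of_set inverse_eq_divide intro!: sum.cong)

lemma expectation_random_perm_Cons:
  fixes f :: "'a list \<Rightarrow> 'b::{banach, second_countable_topology}"
  assumes "finite S" "S \<noteq> {}"
  shows "measure_pmf.expectation (random_perm S) f =
    (\<Sum>x\<in>S. measure_pmf.expectation (random_perm (S - {x})) (\<lambda>xs. f (x # xs)) /\<^sub>R real (card S))"
proof -
  have "measure_pmf.expectation (random_perm S) f =
    (\<Sum>x\<in>S. measure_pmf.expectation (random_perm (S - {x}) \<bind> (\<lambda>xs. return_pmf (x # xs))) f /\<^sub>R real (card S))"
    unfolding random_permutation_of_set[OF assms]
    by (rule pmf_expectation_bind_pmf_of_set) (use assms in \<open>auto simp: set_random_perm\<close>)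
  then show ?thesis
    unfolding map_pmf_def[symmetric] by simp
qed

definition prot_char :: "nat \<Rightarrow> real \<Rightarrow> complex" where
  "prot_char n t = measure_pmf.expectation (random_perm {..<n}) (\<lambda>xs. iexp (t * real (prot_count xs)))"

text \<open>
  An order isomorphism between \<open>S\<close> and an initial segment of the natural numbers carries
  uniform permutations to uniform permutations.
\<close>
lemma expectation_random_perm_card:
  fixes S :: "'a::linorder set" and f :: "nat \<Rightarrow> 'b::{banach, second_countable_topology}"
  assumes "finite S"
  shows "measure_pmf.expectation (random_perm S) (\<lambda>xs. f (prot_count xs)) =
    measure_pmf.expectation (random_perm {..<card S}) (\<lambda>xs. f (prot_count xs))"
proof -
  define h where "h = (!) (sorted_list_of_set S)"
  have "sorted_wrt (<) (sorted_list_of_set S)" by simp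
  then have mono: "strict_mono_on {..<card S} h"
    using assms by (auto simp: h_def strict_mono_on_def sorted_wrt_iff_nth_less)
  have im: "h ` {..<card S} = S"
  proof -
    have "h ` {..<card S} = set (sorted_list_of_set S)"
      unfolding h_def set_conv_nth by auto
    then show ?thesis using assms by simp
  qed
  have S: "random_perm S = map_pmf (map h) (random_perm {..<card S})"
    using strict_mono_on_imp_inj_on[OF mono] permutations_of_set_image_inj[of h "{..<card S}"]
    by (subst map_pmf_of_set_inj)
       (auto simp: im intro!: inj_on_mapI)
  have "measure_pmf.expectation (random_perm S) (\<lambda>xs. f (prot_count xs)) =
     measure_pmf.expectation (random_perm {..<card S}) (\<lambda>xs. f (prot_count (map h xs)))"
    by (subst S) simp
  also have "\<dots> = measure_pmf.expectation (random_perm {..<card S}) (\<lambda>xs. f (prot_count xs))"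
    using mono by (intro expectation_random_perm_cong) (auto simp: prot_count_map permutations_of_set_def)
  finally show ?thesis .
qed

lemma expectation_pair_pmf_mult:
  fixes f :: "'a \<Rightarrow> complex" and g :: "'b \<Rightarrow> complex"
  assumes "finite (set_pmf p)" "finite (set_pmf q)"
  shows "measure_pmf.expectation (pair_pmf p q) (\<lambda>z. f (fst z) * g (snd z)) =
    measure_pmf.expectation p f * measure_pmf.expectation q g"
proof -
  have "measure_pmf.expectation (pair_pmf p q) (\<lambda>z. f (fst z) * g (snd z)) =
     (\<Sum>z\<in>set_pmf p \<times> set_pmf q. pmf (pair_pmf p q) z *\<^sub>R (f (fst z) * g (snd z)))"
    using assms by (intro integral_measure_pmf) auto
  also have "\<dots> = (\<Sum>x\<in>set_pmf p. \<Sum>y\<in>set_pmf q. (pmf p x *\<^sub>R f x) * (pmf q y *\<^sub>R g y))"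
    unfolding sum.cartesian_product
    by (intro sum.cong refl) (auto simp: pmf_pair)
  also have "\<dots> = (\<Sum>x\<in>set_pmf p. pmf p x *\<^sub>R f x) * (\<Sum>y\<in>set_pmf q. pmf q y *\<^sub>R g y)"
    by (simp add: sum_product)
  also have "\<dots> = measure_pmf.expectation p f * measure_pmf.expectation q g"
    using assms by (simp add: integral_measure_pmf[of "set_pmf p"] integral_measure_pmf[of "set_pmf q"])
  finally show ?thesis .
qed

text \<open>
  Sorting the entries of a random permutation into two groups gives two independent random
  permutations; applied twice, this separates the keys of the three subtrees.
\<close>
lemma expectation_random_perm_partition:
  fixes f g :: "'a list \<Rightarrow> complex"
  assumes "finite S"
  shows "measure_pmf.expectation (random_perm S) (\<lambda>zs. f (filter P zs) * g (filter (\<lambda>z. \<not> P z) zs)) =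
    measure_pmf.expectation (random_perm {z\<in>S. P z}) f * measure_pmf.expectation (random_perm {z\<in>S. \<not> P z}) g"
proof -
  have "measure_pmf.expectation (random_perm S) (\<lambda>zs. f (filter P zs) * g (filter (\<lambda>z. \<not> P z) zs)) =
     measure_pmf.expectation (map_pmf (partition P) (random_perm S)) (\<lambda>z. f (fst z) * g (snd z))"
    by (simp add: o_def)
  also have "\<dots> = measure_pmf.expectation (random_perm {z\<in>S. P z}) f * measure_pmf.expectation (random_perm {z\<in>S. \<not> P z}) g"
    unfolding partition_random_permutations[OF assms]
    using assms by (intro expectation_pair_pmf_mult finite_set_random_perm) auto
  finally show ?thesis .
qed

lemma expectation_random_perm_partition3:
  fixes f g h :: "'a::linorder list \<Rightarrow> complex"
  assumes "finite S" "a < b"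
  shows "measure_pmf.expectation (random_perm S)
      (\<lambda>zs. f (filter (\<lambda>z. z \<le> a) zs) * g (filter (\<lambda>z. a < z \<and> z \<le> b) zs) * h (filter (\<lambda>z. b < z) zs)) =
    measure_pmf.expectation (random_perm {z\<in>S. z \<le> a}) f *
    measure_pmf.expectation (random_perm {z\<in>S. a < z \<and> z \<le> b}) g *
    measure_pmf.expectation (random_perm {z\<in>S. b < z}) h"
proof -
  have eq: "filter (\<lambda>z. a < z \<and> z \<le> b) zs = filter (\<lambda>z. z \<le> b) (filter (\<lambda>z. \<not> z \<le> a) zs)"
           "filter (\<lambda>z. b < z) zs = filter (\<lambda>z. \<not> z \<le> b) (filter (\<lambda>z. \<not> z \<le> a) zs)" for zs
    using assms(2) by (auto intro!: filter_cong)
  have eqS: "{z \<in> {z \<in> S. \<not> z \<le> a}. z \<le> b} = {z\<in>S. a < z \<and> z \<le> b}"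
            "{z \<in> {z \<in> S. \<not> z \<le> a}. \<not> z \<le> b} = {z\<in>S. b < z}"
    using assms(2) by auto
  show ?thesis
    using expectation_random_perm_partition[OF assms(1), of f "\<lambda>z. z \<le> a"
        "\<lambda>zs. g (filter (\<lambda>z. z \<le> b) zs) * h (filter (\<lambda>z. \<not> z \<le> b) zs)"]
      expectation_random_perm_partition[of "{z \<in> S. \<not> z \<le> a}" g "\<lambda>z. z \<le> b" h] assms(1)
    unfolding eq eqS mult.assoc by simp
qed

lemma expectation_prot_count_Cons_Cons:
  assumes "x < N + 2" "y < N + 2" "x \<noteq> y" "N > 0"
  defines "a \<equiv> min x y" and "b \<equiv> max x y"
  shows "measure_pmf.expectation (random_perm ({..<N+2} - {x} - {y})) (\<lambda>zs. iexp (t * real (prot_count (x # y # zs)))) =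
    iexp (t * split_toll a (b - a - 1) (N + 1 - b)) *
      (prot_char a t * prot_char (b - a - 1) t * prot_char (N + 1 - b) t)"
proof -
  define S where "S = {..<N+2} - {x} - {y}"
  have ab: "a < b" "b < N + 2" "S = {..<N+2} - {a, b}"
    using assms by (auto simp: min_def max_def S_def)
  have "{z\<in>S. z \<le> a} = {..<a}" "{z\<in>S. a < z \<and> z \<le> b} = {a<..<b}" "{z\<in>S. b < z} = {b<..<N+2}"
    using ab by auto
  then have card: "card {z\<in>S. z \<le> a} = a" "card {z\<in>S. a < z \<and> z \<le> b} = b - a - 1"
      "card {z\<in>S. b < z} = N + 1 - b"
    by simp_all
  have fin: "finite S" by (simp add: S_def)
  define e where "e zs = iexp (t * real (prot_count zs))" for zs :: "nat list"
  have char: "measure_pmf.expectation (random_perm {z\<in>S. Q z}) e = prot_char (card {z\<in>S. Q z}) t" for Q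
    unfolding e_def prot_char_def using fin by (intro expectation_random_perm_card) simp
  have "measure_pmf.expectation (random_perm S) (\<lambda>zs. e (x # y # zs)) =
    measure_pmf.expectation (random_perm S) (\<lambda>zs. iexp (t * split_toll a (b - a - 1) (N + 1 - b)) *
      (e (filter (\<lambda>z. z \<le> a) zs) * e (filter (\<lambda>z. a < z \<and> z \<le> b) zs) * e (filter (\<lambda>z. b < z) zs)))"
  proof (rule expectation_random_perm_cong[OF fin])
    fix zs assume "zs \<in> permutations_of_set S"
    then have zs: "set zs = S" "distinct zs" by (auto dest: permutations_of_setD)
    have "card S = N"
      using assms by (simp add: S_def card_Diff_singleton_if)
    with zs \<open>N > 0\<close> have "zs \<noteq> []" by auto
    have d: "distinct (x # y # zs)" using zs assms by (auto simp: S_def)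
    have len: "length (filter Q zs) = card {z\<in>S. Q z}" for Q
      using distinct_length_filter[OF zs(2), of Q] zs(1) by (simp add: Int_def conj_commute)
    have "real (prot_count (x # y # zs)) = split_toll a (b - a - 1) (N + 1 - b)
        + real (prot_count (filter (\<lambda>z. z \<le> a) zs)) + real (prot_count (filter (\<lambda>z. a < z \<and> z \<le> b) zs))
        + real (prot_count (filter (\<lambda>z. b < z) zs))"
      unfolding prot_count_Cons_Cons[OF d \<open>zs \<noteq> []\<close>, folded a_def b_def] len card
      by (simp add: split_toll_def)
    then show "e (x # y # zs) = iexp (t * split_toll a (b - a - 1) (N + 1 - b)) *
      (e (filter (\<lambda>z. z \<le> a) zs) * e (filter (\<lambda>z. a < z \<and> z \<le> b) zs) * e (filter (\<lambda>z. b < z) zs))"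
      unfolding e_def exp_add[symmetric] by (simp add: algebra_simps)
  qed
  also have "\<dots> = iexp (t * split_toll a (b - a - 1) (N + 1 - b)) *
      (measure_pmf.expectation (random_perm {z\<in>S. z \<le> a}) e * measure_pmf.expectation (random_perm {z\<in>S. a < z \<and> z \<le> b}) e
       * measure_pmf.expectation (random_perm {z\<in>S. b < z}) e)"
    by (simp only: integral_mult_right_zero expectation_random_perm_partition3[OF fin ab(1)])
  finally show ?thesis unfolding char card unfolding e_def S_def .
qed

lemma prot_char_rec:
  assumes "N > 0"
  shows "sum_splits N (\<lambda>i j k. iexp (t * split_toll i j k) * (prot_char i t * prot_char j t * prot_char k t)) =
    of_real (num_splits N) * prot_char (N + 2) t"
proof -
  let ?n = "N + 2"
  define G where "G a b = iexp (t * split_toll a (b - a - 1) (N + 1 - b)) *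
      (prot_char a t * prot_char (b - a - 1) t * prot_char (N + 1 - b) t)" for a b
  define f where "f zs = iexp (t * real (prot_count zs))" for zs :: "nat list"
  have ne: "{..<?n} \<noteq> {}"
    by (metis lessThan_empty_iff add_is_0 zero_neq_numeral)
  have "prot_char ?n t = measure_pmf.expectation (random_perm {..<?n}) f"
    by (simp only: prot_char_def f_def[abs_def])
  also have "\<dots> = (\<Sum>x<?n. measure_pmf.expectation (random_perm ({..<?n} - {x})) (\<lambda>xs. f (x # xs)) /\<^sub>R real ?n)"
    using expectation_random_perm_Cons[OF finite_lessThan ne, of f] by (simp only: card_lessThan)
  also have "\<dots> = (\<Sum>x<?n. (\<Sum>y\<in>{..<?n}-{x}. G (min x y) (max x y) /\<^sub>R real (N + 1)) /\<^sub>R real ?n)"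
  proof (rule sum.cong[OF refl])
    fix x assume x: "x \<in> {..<?n}"
    then have card: "card ({..<?n} - {x}) = N + 1"
      by (subst card_Diff_singleton) simp_all
    then have ne: "{..<?n} - {x} \<noteq> {}"
      by (metis card.empty add_is_0 one_neq_zero)
    have "measure_pmf.expectation (random_perm ({..<?n} - {x})) (\<lambda>xs. f (x # xs)) =
       (\<Sum>y\<in>{..<?n} - {x}. measure_pmf.expectation (random_perm ({..<?n} - {x} - {y})) (\<lambda>zs. f (x # y # zs)) /\<^sub>R real (N + 1))"
      using expectation_random_perm_Cons[OF _ ne, of "\<lambda>xs. f (x # xs)"] unfolding card by blast
    also have "\<dots> = (\<Sum>y\<in>{..<?n} - {x}. G (min x y) (max x y) /\<^sub>R real (N + 1))"
    proof (rule sum.cong[OF refl])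
      fix y assume y: "y \<in> {..<?n} - {x}"
      have "measure_pmf.expectation (random_perm ({..<?n} - {x} - {y})) (\<lambda>zs. f (x # y # zs)) = G (min x y) (max x y)"
        unfolding f_def G_def using x y assms by (intro expectation_prot_count_Cons_Cons) auto
      then show "measure_pmf.expectation (random_perm ({..<?n} - {x} - {y})) (\<lambda>zs. f (x # y # zs)) /\<^sub>R real (N + 1) =
          G (min x y) (max x y) /\<^sub>R real (N + 1)"
        by (simp only:)
    qed
    finally show "measure_pmf.expectation (random_perm ({..<?n} - {x})) (\<lambda>xs. f (x # xs)) /\<^sub>R real ?n =
       (\<Sum>y\<in>{..<?n} - {x}. G (min x y) (max x y) /\<^sub>R real (N + 1)) /\<^sub>R real ?n"
      by (simp only:)
  qed
  also have "\<dots> = (\<Sum>x<?n. \<Sum>y\<in>{..<?n}-{x}. G (min x y) (max x y)) /\<^sub>R (real (N + 1) * real ?n)"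
  proof -
    have "G (min x y) (max x y) /\<^sub>R real (N + 1) /\<^sub>R real ?n = G (min x y) (max x y) /\<^sub>R (real (N + 1) * real ?n)" for x y
      by simp
    then show ?thesis by (simp only: scaleR_sum_right)
  qed
  also have "\<dots> = sum_splits N (\<lambda>i j k. G i (i + j + 1)) / of_real (num_splits N)"
  proof -
    have "real (N + 1) * real ?n = 2 * num_splits N"
      by (simp add: num_splits_def algebra_simps)
    moreover have "(2 * A) /\<^sub>R (2 * num_splits N) = A / of_real (num_splits N)" for A :: complex
      using num_splits_pos[of N] by (simp add: scaleR_conv_of_real field_simps)
    ultimately show ?thesis
      by (simp only: sum_off_diagonal)
  qed
  also have "sum_splits N (\<lambda>i j k. G i (i + j + 1)) =
      sum_splits N (\<lambda>i j k. iexp (t * split_toll i j k) * (prot_char i t * prot_char j t * prot_char k t))"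
  proof (rule sum_splits_cong)
    fix i j k assume "i + j + k = N"
    then have "i + j + 1 - i - 1 = j" "N + 1 - (i + j + 1) = k" by simp_all
    then show "G i (i + j + 1) = iexp (t * split_toll i j k) * (prot_char i t * prot_char j t * prot_char k t)"
      by (simp only: G_def)
  qed
  finally show ?thesis
    using num_splits_pos[of N] by simp
qed

lemma prot_char_small: "n < 3 \<Longrightarrow> prot_char n t = 1"
proof -
  assume n: "n < 3"
  have "prot_char n t = measure_pmf.expectation (random_perm {..<n}) (\<lambda>_. 1)"
    unfolding prot_char_def
  proof (rule expectation_random_perm_cong)
    fix xs assume "xs \<in> permutations_of_set {..<n}"
    then have "distinct xs" "length xs = n"
      using length_finite_permutations_of_set[of xs "{..<n}"] by (auto dest: permutations_of_setD)
    then have "prot_count xs = 0" using n by (simp add: prot_count_short)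
    then show "iexp (t * real (prot_count xs)) = 1" by simp
  qed simp
  then show ?thesis by simp
qed

lemma norm_prot_char_le: "norm (prot_char n t) \<le> 1"
proof -
  have "norm (prot_char n t) \<le> measure_pmf.expectation (random_perm {..<n}) (\<lambda>xs. norm (iexp (t * real (prot_count xs))))"
    unfolding prot_char_def by (rule integral_norm_bound)
  also have "\<dots> = 1"
    by (simp add: norm_exp_eq_Re)
  finally show ?thesis .
qed

section \<open>Gaussian approximation for split recursions\<close>

lemma norm_triple_product_diff_le:
  fixes a b c x y z :: "'b::real_normed_field"
  assumes "norm b \<le> 1" "norm c \<le> 1" "norm x \<le> 1" "norm y \<le> 1"
  shows "norm (a * b * c - x * y * z) \<le> norm (a - x) + norm (b - y) + norm (c - z)"
proof -
  have "a * b * c - x * y * z = (a - x) * (b * c) + (b - y) * (x * c) + (c - z) * (x * y)"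
    by (simp add: algebra_simps)
  also have "norm \<dots> \<le> norm (a - x) * norm (b * c) + norm (b - y) * norm (x * c) + norm (c - z) * norm (x * y)"
    by (intro order_trans[OF norm_triangle_ineq] add_mono) (simp_all add: norm_mult)
  also have "\<dots> \<le> norm (a - x) * 1 + norm (b - y) * 1 + norm (c - z) * 1"
    using assms by (intro add_mono mult_left_mono) (auto simp: norm_mult intro: mult_le_one)
  finally show ?thesis by simp
qed

lemma exp_taylor2:
  fixes z :: complex
  shows "norm (exp z - (1 + z + z\<^sup>2 / 2)) \<le> exp (norm z) * norm z ^ 3"
proof -
  have "norm (exp z - (1 + z + z\<^sup>2 / 2)) = norm (exp z - (\<Sum>i\<le>2. z ^ i / fact i))"
    by (simp add: numeral_2_eq_2)
  also have "\<dots> \<le> exp \<bar>Re z\<bar> * (norm z ^ Suc 2) / fact 2"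
    by (rule Taylor_exp)
  also have "\<dots> \<le> exp \<bar>Re z\<bar> * norm z ^ 3"
    by (simp add: numeral_3_eq_3)
  also have "\<dots> \<le> exp (norm z) * norm z ^ 3"
    by (intro mult_right_mono) (simp_all add: abs_Re_le_cmod)
  finally show ?thesis .
qed

text \<open>
  In the exponential series of \<open>w = itb - t\<^sup>2h/2\<close> the terms of order \<open>t\<^sup>2\<close> are \<open>- t\<^sup>2h/2\<close>, from \<open>w\<close>, and
  \<open>- t\<^sup>2b\<^sup>2/2\<close>, from \<open>w\<^sup>2/2\<close>. This is why \<open>b\<^sup>2 + h\<close> is the quantity that has to vanish on average.
\<close>
lemma exp_second_order:
  fixes t b h K :: real
  defines "w \<equiv> \<i> * of_real (t * b) - of_real (t\<^sup>2 * h / 2)"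
  assumes t: "\<bar>t\<bar> \<le> 1" and b: "\<bar>b\<bar> \<le> K" and h: "\<bar>h\<bar> \<le> K"
  shows "norm (exp w - 1 - (\<i> * of_real (t * b) - of_real (t\<^sup>2 / 2 * (b\<^sup>2 + h))))
           \<le> (8 * K ^ 3 * exp (2 * K) + K\<^sup>2) * \<bar>t\<bar> ^ 3"
proof -
  have K: "K \<ge> 0" using b by linarith
  have t2: "t\<^sup>2 \<le> \<bar>t\<bar>" using t abs_le_square_iff[of t 1]
    by (metis abs_ge_zero abs_mult_self_eq mult_left_le power2_eq_square)
  have w: "norm w \<le> 2 * K * \<bar>t\<bar>"
  proof -
    have "norm w \<le> \<bar>t * b\<bar> + \<bar>t\<^sup>2 * h / 2\<bar>"
      unfolding w_def by (rule order_trans[OF norm_triangle_ineq4]) (simp add: norm_mult del: of_real_mult of_real_divide)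
    also have "\<dots> \<le> \<bar>t\<bar> * K + \<bar>t\<bar> * K"
    proof (rule add_mono)
      show "\<bar>t * b\<bar> \<le> \<bar>t\<bar> * K"
        using b by (simp add: abs_mult mult_left_mono)
      have "t\<^sup>2 * \<bar>h\<bar> \<le> \<bar>t\<bar> * K"
        using t2 h by (intro mult_mono) auto
      moreover have "\<bar>t\<^sup>2 * h / 2\<bar> = t\<^sup>2 * \<bar>h\<bar> / 2"
        by (simp add: abs_mult)
      moreover have "0 \<le> \<bar>t\<bar> * K"
        using K by simp
      ultimately show "\<bar>t\<^sup>2 * h / 2\<bar> \<le> \<bar>t\<bar> * K"
        by linarith
    qed
    finally show ?thesis by simp
  qed
  have w': "norm w \<le> 2 * K"
    using w t K by (metis abs_ge_zero mult.commute mult_left_le mult_nonneg_nonneg order_trans zero_le_numeral)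
  have "exp w - 1 - (\<i> * of_real (t * b) - of_real (t\<^sup>2 / 2 * (b\<^sup>2 + h))) =
      (exp w - (1 + w + w\<^sup>2 / 2)) + (of_real (t ^ 4 * h\<^sup>2 / 8) - \<i> * of_real (t ^ 3 * b * h / 2))"
    unfolding w_def by (simp add: field_simps power2_eq_square power3_eq_cube power4_eq_xxxx)
  also have "norm \<dots> \<le> exp (norm w) * norm w ^ 3 + (\<bar>t ^ 4 * h\<^sup>2 / 8\<bar> + \<bar>t ^ 3 * b * h / 2\<bar>)"
    by (intro order_trans[OF norm_triangle_ineq] add_mono exp_taylor2 order_trans[OF norm_triangle_ineq4])
       (simp_all only: norm_mult norm_ii norm_of_real mult_1 order_refl)
  also have "\<dots> \<le> exp (2 * K) * (2 * K * \<bar>t\<bar>) ^ 3 + (\<bar>t\<bar> ^ 3 * K\<^sup>2 / 8 + \<bar>t\<bar> ^ 3 * K\<^sup>2 / 2)"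
  proof (intro add_mono mult_mono power_mono w)
    have "\<bar>t ^ 4\<bar> \<le> \<bar>t\<bar> ^ 3"
      using power_decreasing[of 3 4 "\<bar>t\<bar>"] t unfolding power_abs[symmetric] by simp
    moreover have "\<bar>h\<^sup>2\<bar> \<le> K\<^sup>2"
      using h power_mono[of "\<bar>h\<bar>" K 2] by simp
    ultimately show "\<bar>t ^ 4 * h\<^sup>2 / 8\<bar> \<le> \<bar>t\<bar> ^ 3 * K\<^sup>2 / 8"
      by (simp add: abs_mult mult_mono)
    have "\<bar>b\<bar> * \<bar>h\<bar> \<le> K * K" using b h K by (intro mult_mono) auto
    then show "\<bar>t ^ 3 * b * h / 2\<bar> \<le> \<bar>t\<bar> ^ 3 * K\<^sup>2 / 2"
      by (simp add: abs_mult power_abs power2_eq_square mult.assoc mult_left_mono)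
  qed (use w' K in auto)
  also have "\<dots> \<le> (8 * K ^ 3 * exp (2 * K) + K\<^sup>2) * \<bar>t\<bar> ^ 3"
    by (simp add: power_mult_distrib algebra_simps)
  finally show ?thesis .
qed

text \<open>
  The bound \<open>C n |t|\<^sup>3\<close> passes through the induction because the three sizes add up to \<open>n - 2\<close>:
  the inherited errors use up \<open>C (n - 2) |t|\<^sup>3\<close> and leave room for a new error of \<open>C |t|\<^sup>3\<close>, with
  \<open>C\<close> the constant of the second order expansion. That \<open>v\<close> is nonnegative, and hence that the
  Gaussian has modulus at most 1, follows from the assumption on \<open>b\<^sup>2 + h\<close> by induction.
\<close>
lemma gaussian_approximation:
  fixes \<phi> :: "nat \<Rightarrow> real \<Rightarrow> complex" and m v :: "nat \<Rightarrow> real"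
    and \<tau> :: "nat \<Rightarrow> nat \<Rightarrow> nat \<Rightarrow> real" and K :: real
  defines "b \<equiv> \<lambda>i j k. \<tau> i j k + m i + m j + m k - m (i + j + k + 2)"
    and "h \<equiv> \<lambda>i j k. v i + v j + v k - v (i + j + k + 2)"
  assumes small: "\<And>n t. n < 3 \<Longrightarrow> \<phi> n t = 1" "\<And>n. n < 3 \<Longrightarrow> m n = 0" "\<And>n. n < 3 \<Longrightarrow> v n = 0"
    and norm_le: "\<And>n t. norm (\<phi> n t) \<le> 1"
    and rec: "\<And>N t. N > 0 \<Longrightarrow>
      sum_splits N (\<lambda>i j k. iexp (t * \<tau> i j k) * (\<phi> i t * \<phi> j t * \<phi> k t)) = of_real (num_splits N) * \<phi> (N + 2) t"
    and mean: "\<And>N. N > 0 \<Longrightarrow> sum_splits N b = 0"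
    and var: "\<And>N. N > 0 \<Longrightarrow> sum_splits N (\<lambda>i j k. (b i j k)\<^sup>2 + h i j k) = 0"
    and bounded: "\<And>i j k. \<bar>b i j k\<bar> \<le> K" "\<And>i j k. \<bar>h i j k\<bar> \<le> K"
  shows "\<exists>C. \<forall>n t. \<bar>t\<bar> \<le> 1 \<longrightarrow>
    norm (\<phi> n t - exp (\<i> * of_real (t * m n) - of_real (t\<^sup>2 * v n / 2))) \<le> C * real n * \<bar>t\<bar> ^ 3"
proof -
  define C where "C = 8 * K ^ 3 * exp (2 * K) + K\<^sup>2"
  have "K \<ge> 0" using bounded(1)[of 0 0 0] by linarith
  then have "C \<ge> 0" by (simp add: C_def)
  have v_nonneg: "v n \<ge> 0" for n
  proof (induction n rule: less_induct)
    case (less n)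
    show ?case
    proof (cases "n < 3")
      case False
      then obtain N where n: "n = N + 2" and N: "N > 0"
        by (intro that[of "n - 2"]) auto
      have "sum_splits N (\<lambda>i j k. (b i j k)\<^sup>2 + h i j k) =
        sum_splits N (\<lambda>i j k. ((b i j k)\<^sup>2 + v i + v j + v k) - v n)"
        by (rule sum_splits_cong) (simp add: h_def n)
      then have "num_splits N * v n = sum_splits N (\<lambda>i j k. (b i j k)\<^sup>2 + v i + v j + v k)"
        using var[OF N] by (simp add: sum_splits_diff sum_splits_const)
      also have "\<dots> \<ge> sum_splits N (\<lambda>_ _ _. 0)"
        by (intro sum_splits_mono add_nonneg_nonneg less) (auto simp: n)
      finally show ?thesis
        using num_splits_pos[of N] by (simp add: sum_splits_const zero_le_mult_iff)
    qed (simp add: small)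
  qed
  define \<psi> where "\<psi> n t = exp (\<i> * of_real (t * m n) - of_real (t\<^sup>2 * v n / 2))" for n and t :: real
  have norm_\<psi>: "norm (\<psi> n t) \<le> 1" for n t
    using v_nonneg[of n] by (simp add: \<psi>_def norm_exp_eq_Re)
  define w where "w t i j k = \<i> * of_real (t * b i j k) - of_real (t\<^sup>2 * h i j k / 2)" for t :: real and i j k
  have \<psi>_split: "iexp (t * \<tau> i j k) * (\<psi> i t * \<psi> j t * \<psi> k t) = \<psi> (i + j + k + 2) t * exp (w t i j k)" for t i j k
    unfolding \<psi>_def w_def b_def h_def exp_add[symmetric]
    by (rule arg_cong[of _ _ exp]) (simp add: field_simps)
  have one_step: "norm (sum_splits N (\<lambda>i j k. exp (w t i j k) - 1)) \<le> num_splits N * (C * \<bar>t\<bar> ^ 3)"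
    if "N > 0" "\<bar>t\<bar> \<le> 1" for N t
  proof -
    let ?e = "\<lambda>i j k. \<i> * of_real (t * b i j k) - complex_of_real (t\<^sup>2 / 2 * ((b i j k)\<^sup>2 + h i j k))"
    have "sum_splits N ?e = \<i> * of_real t * of_real (sum_splits N b)
        - of_real (t\<^sup>2 / 2) * of_real (sum_splits N (\<lambda>i j k. (b i j k)\<^sup>2 + h i j k))"
      by (simp only: sum_splits_diff sum_splits_cmult of_real_mult sum_splits_of_real mult.assoc)
    then have "sum_splits N ?e = 0"
      using mean[OF that(1)] var[OF that(1)] by simp
    then have "norm (sum_splits N (\<lambda>i j k. exp (w t i j k) - 1)) =
        norm (sum_splits N (\<lambda>i j k. exp (w t i j k) - 1 - ?e i j k))"
      by (simp only: sum_splits_diff diff_zero)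
    also have "\<dots> \<le> sum_splits N (\<lambda>i j k. norm (exp (w t i j k) - 1 - ?e i j k))"
      by (rule norm_sum_splits_le)
    also have "\<dots> \<le> sum_splits N (\<lambda>i j k. C * \<bar>t\<bar> ^ 3)"
      unfolding C_def w_def by (intro sum_splits_mono exp_second_order that bounded)
    finally show ?thesis by (simp only: sum_splits_const)
  qed
  have "norm (\<phi> n t - \<psi> n t) \<le> C * real n * \<bar>t\<bar> ^ 3" if t: "\<bar>t\<bar> \<le> 1" for n t
  proof (induction n rule: less_induct)
    case (less n)
    show ?case
    proof (cases "n < 3")
      case True
      then show ?thesis using \<open>C \<ge> 0\<close> by (simp add: small \<psi>_def)
    next
      case False
      then obtain N where n: "n = N + 2" and N: "N > 0"
        by (intro that[of "n - 2"]) auto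
      have "of_real (num_splits N) * (\<phi> n t - \<psi> n t) =
        sum_splits N (\<lambda>i j k. iexp (t * \<tau> i j k) * (\<phi> i t * \<phi> j t * \<phi> k t)) - \<psi> n t * sum_splits N (\<lambda>i j k. of_real 1)"
        unfolding sum_splits_of_real sum_splits_const rec[OF N, of t] n by (simp add: algebra_simps)
      also have "\<dots> = sum_splits N (\<lambda>i j k. iexp (t * \<tau> i j k) * (\<phi> i t * \<phi> j t * \<phi> k t - \<psi> i t * \<psi> j t * \<psi> k t)
           + \<psi> n t * (exp (w t i j k) - 1))"
        unfolding sum_splits_cmult[symmetric] sum_splits_diff[symmetric]
      proof (intro sum_splits_cong)
        fix i j k assume "i + j + k = N"
        then have "iexp (t * \<tau> i j k) * (\<psi> i t * \<psi> j t * \<psi> k t) = \<psi> n t * exp (w t i j k)"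
          by (simp only: \<psi>_split n)
        then show "iexp (t * \<tau> i j k) * (\<phi> i t * \<phi> j t * \<phi> k t) - \<psi> n t * complex_of_real 1 =
            iexp (t * \<tau> i j k) * (\<phi> i t * \<phi> j t * \<phi> k t - \<psi> i t * \<psi> j t * \<psi> k t) + \<psi> n t * (exp (w t i j k) - 1)"
          by (simp only: right_diff_distrib) simp
      qed
      also have "\<dots> = sum_splits N (\<lambda>i j k. iexp (t * \<tau> i j k) * (\<phi> i t * \<phi> j t * \<phi> k t - \<psi> i t * \<psi> j t * \<psi> k t))
           + \<psi> n t * sum_splits N (\<lambda>i j k. exp (w t i j k) - 1)"
        by (simp only: sum_splits_add sum_splits_cmult)
      also have "norm \<dots> \<le> sum_splits N (\<lambda>i j k. C * real N * \<bar>t\<bar> ^ 3) + 1 * (num_splits N * (C * \<bar>t\<bar> ^ 3))"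
      proof (intro order_trans[OF norm_triangle_ineq] add_mono)
        show "norm (\<psi> n t * sum_splits N (\<lambda>i j k. exp (w t i j k) - 1)) \<le> 1 * (num_splits N * (C * \<bar>t\<bar> ^ 3))"
          unfolding norm_mult by (intro mult_mono norm_\<psi> one_step N t) auto
        have "norm (iexp (t * \<tau> i j k) * (\<phi> i t * \<phi> j t * \<phi> k t - \<psi> i t * \<psi> j t * \<psi> k t))
           \<le> C * real N * \<bar>t\<bar> ^ 3" if ijk: "i + j + k = N" for i j k
        proof -
          have "norm (iexp (t * \<tau> i j k) * (\<phi> i t * \<phi> j t * \<phi> k t - \<psi> i t * \<psi> j t * \<psi> k t))
            = norm (\<phi> i t * \<phi> j t * \<phi> k t - \<psi> i t * \<psi> j t * \<psi> k t)"
            by (simp add: norm_mult norm_exp_eq_Re)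
          also have "\<dots> \<le> norm (\<phi> i t - \<psi> i t) + norm (\<phi> j t - \<psi> j t) + norm (\<phi> k t - \<psi> k t)"
            by (intro norm_triple_product_diff_le norm_le norm_\<psi>)
          also have "\<dots> \<le> C * real i * \<bar>t\<bar> ^ 3 + C * real j * \<bar>t\<bar> ^ 3 + C * real k * \<bar>t\<bar> ^ 3"
            using ijk n by (intro add_mono less) auto
          also have "\<dots> = C * real N * \<bar>t\<bar> ^ 3"
            by (simp add: ijk[symmetric] algebra_simps)
          finally show ?thesis .
        qed
        then show "norm (sum_splits N (\<lambda>i j k. iexp (t * \<tau> i j k) * (\<phi> i t * \<phi> j t * \<phi> k t - \<psi> i t * \<psi> j t * \<psi> k t)))
           \<le> sum_splits N (\<lambda>i j k. C * real N * \<bar>t\<bar> ^ 3)"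
          by (intro order_trans[OF norm_sum_splits_le] sum_splits_mono)
      qed
      also have "\<dots> = num_splits N * (C * (real N + 1) * \<bar>t\<bar> ^ 3)"
        by (simp add: sum_splits_const algebra_simps)
      finally have "norm (\<phi> n t - \<psi> n t) \<le> C * (real N + 1) * \<bar>t\<bar> ^ 3"
        using num_splits_pos[of N] by (simp add: norm_mult)
      also have "\<dots> \<le> C * real n * \<bar>t\<bar> ^ 3"
        using \<open>C \<ge> 0\<close> by (intro mult_right_mono mult_left_mono) (simp_all add: n)
      finally show ?thesis .
    qed
  qed
  then show ?thesis unfolding \<psi>_def by blast
qed

section \<open>Logarithmic polynomials in one minus the indeterminate\<close>

definition compl_poly :: "real poly \<Rightarrow> real fps" where
  "compl_poly p = fps_of_poly (pcompose p [:1, -1:])"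

definition geo :: "real fps" where "geo = Abs_fps (\<lambda>_. 1)"

text \<open>
  The series of \<open>- log (1 - X)\<close>; its constant term vanishes since \<open>1 / 0 = 0\<close>.
\<close>
definition neglog :: "real fps" where "neglog = Abs_fps (\<lambda>n. 1 / real n)"

definition logpoly :: "real poly \<Rightarrow> real poly \<Rightarrow> real poly \<Rightarrow> real fps" where
  "logpoly p q r = compl_poly p + compl_poly q * neglog + compl_poly r * neglog ^ 2"

lemma compl_poly_add: "compl_poly (p + q) = compl_poly p + compl_poly q"
  by (simp add: compl_poly_def pcompose_add fps_of_poly_add)

lemma compl_poly_diff: "compl_poly (p - q) = compl_poly p - compl_poly q"
  by (simp add: compl_poly_def pcompose_diff fps_of_poly_diff)

lemma compl_poly_mult: "compl_poly (p * q) = compl_poly p * compl_poly q"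
  by (simp add: compl_poly_def pcompose_mult fps_of_poly_mult)

lemma compl_poly_const: "compl_poly [:c:] = fps_const c"
  by (simp add: compl_poly_def fps_of_poly_const)

lemma compl_poly_0 [simp]: "compl_poly 0 = 0"
  by (simp add: compl_poly_def)

lemma compl_poly_1 [simp]: "compl_poly 1 = 1"
  by (simp add: compl_poly_def pcompose_1)

lemma compl_poly_numeral [simp]: "compl_poly (numeral n) = numeral n"
  by (simp add: numeral_poly compl_poly_const numeral_fps_const)

lemma compl_poly_power: "compl_poly (p ^ n) = compl_poly p ^ n"
  by (induction n) (simp_all add: compl_poly_mult)

lemma compl_poly_linear: "compl_poly [:0, 1:] = 1 - fps_X"
proof -
  have "fps_of_poly [:1, -1:] = (1 - fps_X :: real fps)"
    by (simp add: fps_of_poly_pCons fps_eq_iff)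
  then show ?thesis by (simp add: compl_poly_def pcompose_pCons)
qed

lemmas compl_poly_hom = compl_poly_add compl_poly_diff compl_poly_mult compl_poly_power

lemma fps_deriv_compl_poly: "fps_deriv (compl_poly p) = - compl_poly (pderiv p)"
proof -
  have "pderiv (pcompose p [:1, -1:]) = - pcompose (pderiv p) [:1, -1:]"
    by (simp add: pderiv_pcompose pderiv_pCons)
  then show ?thesis
    by (simp add: compl_poly_def fps_of_poly_pderiv [symmetric] fps_of_poly_uminus)
qed

lemma geo_nth [simp]: "geo $ n = 1"
  by (simp add: geo_def)

lemma geo_pow2_nth: "(geo ^ 2) $ n = real n + 1"
  by (simp add: power2_eq_square fps_mult_nth)

lemma geo_mult: "geo * (1 - fps_X) = 1"
  by (rule fps_ext) (simp add: geo_def right_diff_distrib)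

lemma fps_deriv_neglog: "fps_deriv neglog = geo"
  by (rule fps_ext) (simp add: neglog_def geo_def field_simps del: of_nat_Suc)

lemma fps_deriv_geo: "fps_deriv geo = geo ^ 2"
proof -
  have "fps_deriv (geo * (1 - fps_X)) = 0"
    using geo_mult by simp
  then have "fps_deriv geo * (1 - fps_X) = geo"
    by (simp add: algebra_simps)
  then have "fps_deriv geo * (geo * (1 - fps_X)) = geo ^ 2"
    by (metis mult.assoc mult.commute power2_eq_square)
  then show ?thesis by (simp add: geo_mult)
qed

text \<open>
  The Euler operator \<open>D\<^sup>2 (d/dX)\<^sup>2\<close> preserves logarithmic polynomials, so a differential equation
  between them becomes three identities between polynomials, one for each power of the
  logarithm. The minus signs come from \<open>d/dX = - d/dD\<close>.
\<close>
lemma logpoly_euler: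
  "(1 - fps_X) ^ 2 * fps_deriv (fps_deriv (logpoly p q r)) =
     logpoly ([:0, 1:] ^ 2 * pderiv (pderiv p) - 2 * [:0, 1:] * pderiv q + q + 2 * r)
             ([:0, 1:] ^ 2 * pderiv (pderiv q) - 4 * [:0, 1:] * pderiv r + 2 * r)
             ([:0, 1:] ^ 2 * pderiv (pderiv r))"
proof -
  define D :: "real fps" where "D = 1 - fps_X"
  have GD: "geo * D = 1" by (simp add: D_def geo_mult)
  have "D ^ 2 * fps_deriv (fps_deriv (logpoly p q r)) =
     D^2 * compl_poly (pderiv (pderiv p)) - 2 * D * (geo * D) * compl_poly (pderiv q)
     + (geo * D)^2 * compl_poly q + 2 * (geo * D)^2 * compl_poly r
     + (D^2 * compl_poly (pderiv (pderiv q)) - 4 * D * (geo * D) * compl_poly (pderiv r)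
     + 2 * (geo * D)^2 * compl_poly r) * neglog + D^2 * compl_poly (pderiv (pderiv r)) * neglog ^ 2"
    by (simp add: logpoly_def fps_deriv_compl_poly fps_deriv_neglog fps_deriv_geo power2_eq_square algebra_simps)
  also have "\<dots> = logpoly ([:0, 1:] ^ 2 * pderiv (pderiv p) - 2 * [:0, 1:] * pderiv q + q + 2 * r)
             ([:0, 1:] ^ 2 * pderiv (pderiv q) - 4 * [:0, 1:] * pderiv r + 2 * r)
             ([:0, 1:] ^ 2 * pderiv (pderiv r))"
    unfolding GD logpoly_def compl_poly_hom compl_poly_linear compl_poly_numeral D_def[symmetric] by simp
  finally show ?thesis by (simp add: D_def)
qed

lemma compl_poly_nth:
  "compl_poly p $ 0 = poly p 1" "compl_poly p $ 1 = - poly (pderiv p) 1"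
  "compl_poly p $ 2 = poly (pderiv (pderiv p)) 1 / 2"
proof -
  show 0: "compl_poly p $ 0 = poly p 1" for p
    by (simp add: compl_poly_def poly_0_coeff_0 [symmetric] poly_pcompose)
  show 1: "compl_poly p $ 1 = - poly (pderiv p) 1" for p
    using arg_cong[OF fps_deriv_compl_poly[of p], of "\<lambda>f. f $ 0"] by (simp add: 0)
  show "compl_poly p $ 2 = poly (pderiv (pderiv p)) 1 / 2"
    using arg_cong[OF fps_deriv_compl_poly[of p], of "\<lambda>f. f $ 1"] 1[of "pderiv p"]
    by (simp add: numeral_2_eq_2)
qed

lemma logpoly_nth:
  "logpoly p q r $ 0 = poly p 1"
  "logpoly p q r $ 1 = - poly (pderiv p) 1 + poly q 1"
  "logpoly p q r $ 2 = poly (pderiv (pderiv p)) 1 / 2 - poly (pderiv q) 1 + poly q 1 / 2 + poly r 1"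
  by (simp_all add: logpoly_def fps_mult_nth power2_eq_square neglog_def compl_poly_nth(1)
        compl_poly_nth(2)[unfolded One_nat_def] compl_poly_nth(3)[unfolded numeral_2_eq_2] numeral_2_eq_2)

lemma fps_of_poly_mult_bounded:
  assumes "\<And>n. \<bar>f $ n\<bar> \<le> (B::real)"
  shows "\<exists>C. \<forall>n. \<bar>(fps_of_poly p * f) $ n\<bar> \<le> C"
proof (intro exI allI)
  fix n
  have "\<bar>(fps_of_poly p * f) $ n\<bar> \<le> (\<Sum>i=0..n. \<bar>coeff p i\<bar> * B)"
    unfolding fps_mult_nth
    by (rule order_trans[OF sum_abs]) (auto intro!: sum_mono mult_left_mono assms simp: abs_mult)
  also have "\<dots> \<le> (\<Sum>i\<in>{0..n} \<union> {..degree p}. \<bar>coeff p i\<bar> * B)"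
    using assms[of 0] by (intro sum_mono2) auto
  also have "\<dots> = (\<Sum>i\<in>{..degree p}. \<bar>coeff p i\<bar> * B)"
    by (rule sum.mono_neutral_right) (auto intro: coeff_eq_0)
  finally show "\<bar>(fps_of_poly p * f) $ n\<bar> \<le> (\<Sum>i\<in>{..degree p}. \<bar>coeff p i\<bar> * B)" .
qed

text \<open>
  The coefficient is the sum of \<open>1 / (i (n - i))\<close> for \<open>0 < i < n\<close>: there are \<open>n - 1\<close> terms, and each
  denominator is at least \<open>n - 1\<close>.
\<close>
lemma neglog_sq_nth_le: "\<bar>(neglog ^ 2) $ n\<bar> \<le> 1"
proof -
  have "(neglog ^ 2) $ n = (\<Sum>i=0..n. 1 / (real i * real (n - i)))"
    by (simp add: power2_eq_square fps_mult_nth neglog_def)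
  moreover have "\<dots> \<ge> 0"
    by (intro sum_nonneg) simp
  ultimately have "\<bar>(neglog ^ 2) $ n\<bar> = (\<Sum>i=0..n. 1 / (real i * real (n - i)))"
    by simp
  also have "\<dots> = (\<Sum>i\<in>{1..<n}. 1 / (real i * real (n - i)))"
    by (rule sum.mono_neutral_right) auto
  also have "\<dots> \<le> (\<Sum>i\<in>{1..<n}. 1 / real (n - 1))"
  proof (rule sum_mono)
    fix i assume i: "i \<in> {1..<n}"
    then obtain k where n: "n = i + Suc k" by (auto dest: less_imp_Suc_add)
    with i obtain l where "i = Suc l" by (cases i) auto
    with n have "n - 1 \<le> i * (n - i)" by simp
    then have "real (n - 1) \<le> real i * real (n - i)"
      by (metis of_nat_le_iff of_nat_mult)
    then show "1 / (real i * real (n - i)) \<le> 1 / real (n - 1)"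
      using i by (intro divide_left_mono) (auto intro!: mult_pos_pos)
  qed
  also have "\<dots> \<le> 1" by (cases n) simp_all
  finally show ?thesis .
qed

lemma logpoly_bounded: "\<exists>C. \<forall>n. \<bar>logpoly p q r $ n\<bar> \<le> C"
proof -
  have "\<bar>(1::real fps) $ n\<bar> \<le> 1" "\<bar>neglog $ n\<bar> \<le> 1" for n
    by (simp_all add: neglog_def divide_simps)
  from fps_of_poly_mult_bounded[OF this(1), of "pcompose p [:1, -1:]"]
       fps_of_poly_mult_bounded[OF this(2), of "pcompose q [:1, -1:]"]
       fps_of_poly_mult_bounded[OF neglog_sq_nth_le, of "pcompose r [:1, -1:]"]
  obtain B C E where "\<bar>(compl_poly p * 1) $ n\<bar> \<le> B" "\<bar>(compl_poly q * neglog) $ n\<bar> \<le> C"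
     "\<bar>(compl_poly r * neglog ^ 2) $ n\<bar> \<le> E" for n
    unfolding compl_poly_def by metis
  note bounds = this
  have "\<bar>logpoly p q r $ n\<bar> \<le> B + C + E" for n
    using bounds[of n] unfolding logpoly_def fps_add_nth mult_1_right by linarith
  then show ?thesis by blast
qed

section \<open>The generating functions of the first two moments\<close>

text \<open>
  The mean is \<open>mean_rate * (n + 1) - 1/2\<close> plus a bounded remainder, and the count minus
  \<open>mean_rate * (n + 1) - 1/2\<close> has the second moment \<open>var_rate * (n + 1)\<close> plus a bounded remainder.
  Both remainders have logarithmic polynomials as generating functions. The coefficients
  below solve the differential equations \<open>mean_rem_gf_ode\<close> and \<open>second_moment_gf_ode\<close> power by power in \<open>D\<close>; the
  coefficients of \<open>D\<^sup>3\<close> and \<open>D\<^sup>-\<^sup>2\<close>, which the equations leave free, are determined by trees with no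
  key and with one key. In this way \<open>D\<^sup>-\<^sup>2\<close> gets the coefficient \<open>var_rate\<close> in the second moment;
  in the mean its vanishing is what fixes \<open>mean_rate\<close>.
\<close>
definition mean_rate :: real where "mean_rate = 57 / 700"

definition var_rate :: real where "var_rate = 1692302314867 / 43692253605000"

definition mean_rem0 :: "real poly" where
  "mean_rem0 = [:2, -7, 24, 57 / 25, -28, 66 / 7, -11 / 4, 1 / 2, -1 / 25:]"

definition mean_rem1 :: "real poly" where
  "mean_rem1 = [:0, 0, 0, -30:]"

definition sq_rem0 :: "real poly" where
  "sq_rem0 = [:-57 / 70, 214 / 25, -18903 / 350, -1636354399 / 45045000, 13899 / 350, 222801 /
     1225, 26079 / 700, -87452201 / 236250, 857057 / 8750, 3352981 / 21175, -30319 / 350,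
     51633087 / 1656200, -4508251 / 551250, 55919 / 35000, -7443 / 30800, 47 / 1700, -2 /
     975, 6 / 83125:]"

definition sq_rem1 :: "real poly" where
  "sq_rem1 = [:0, 0, 0, 91752 / 875, 0, 720 / 7, -510, 616 / 15, 2232 / 5, -8340 / 77, 165 / 7,
     -45 / 13, 8 / 35:]"

definition sq_rem2 :: "real poly" where
  "sq_rem2 = [:0, 0, 0, 0, 0, 0, 0, 300:]"

definition mean_rem_gf :: "real fps" where "mean_rem_gf = logpoly mean_rem0 mean_rem1 0"

definition sq_rem_gf :: "real fps" where "sq_rem_gf = logpoly sq_rem0 sq_rem1 sq_rem2"

definition second_moment_gf :: "real fps" where "second_moment_gf = fps_const var_rate * geo ^ 2 + sq_rem_gf"

text \<open>
  The generating function of the indicator of the sizes of a leaf; \<open>geo - leaf_sizes\<close> is that of the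
  sizes which are allowed below a protected node.
\<close>
definition leaf_sizes :: "real fps" where "leaf_sizes = fps_X + fps_X ^ 2"

text \<open>
  The part of \<open>mean_rem_gf\<close> at the sizes that are allowed below a protected node; the removed
  coefficients are those at 1 and 2.
\<close>
definition no_leaf_mean_gf :: "real fps" where
  "no_leaf_mean_gf = mean_rem_gf - fps_const (59 / 175) * fps_X - fps_const (179 / 700) * fps_X ^ 2"

lemmas poly_defs = mean_rem0_def mean_rem1_def sq_rem0_def sq_rem1_def sq_rem2_def

lemma mean_rem_eq0: "[:0,1:]^2 * pderiv (pderiv mean_rem0) - 2 * [:0,1:] * pderiv mean_rem1 + mean_rem1 =
   6 * mean_rem0 - 6 * [:2,-3,1:] + 6 * [:0,1:] * [:2,-3,1:]^2 - 2 * [:0,1:]^2 * [:2,-3,1:]^3 - 2 * [:0,1:]^2"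
  unfolding poly_defs by (simp add: pderiv_pCons power2_eq_square power3_eq_cube numeral_poly)

lemma mean_rem_eq1: "[:0,1:]^2 * pderiv (pderiv mean_rem1) = 6 * mean_rem1"
  unfolding poly_defs by (simp add: pderiv_pCons power2_eq_square power3_eq_cube numeral_poly)

lemma sq_rem_eq0: "[:0,1:]^2 * pderiv (pderiv sq_rem0) - 2 * [:0,1:] * pderiv sq_rem1 + sq_rem1 + 2 * sq_rem2 =
   6 * sq_rem0 + 6 * [:2,-3,1:] - 6 * [:0,1:] * [:2,-3,1:]^2 + 2 * [:0,1:]^2 * [:2,-3,1:]^3
   + 12 * mean_rem0^2 * [:0,1:] - 12 * mean_rem0
   + 12 * (mean_rem0 - [:59/175:] * (1 - [:0,1:]) - [:179/700:] * (1 - [:0,1:])^2) * (1 - [:0,1:] * [:2,-3,1:])^2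
   + 2 * [:1 - 6 * 293/700:] * [:0,1:]^2"
  unfolding poly_defs by (simp add: pderiv_pCons power2_eq_square power3_eq_cube numeral_poly one_pCons)

lemma sq_rem_eq1: "[:0,1:]^2 * pderiv (pderiv sq_rem1) - 4 * [:0,1:] * pderiv sq_rem2 + 2 * sq_rem2 =
   6 * sq_rem1 + 24 * mean_rem0 * mean_rem1 * [:0,1:] - 12 * mean_rem1
   + 12 * mean_rem1 * (1 - [:0,1:] * [:2,-3,1:])^2"
  unfolding poly_defs by (simp add: pderiv_pCons power2_eq_square power3_eq_cube numeral_poly one_pCons)

lemma sq_rem_eq2: "[:0,1:]^2 * pderiv (pderiv sq_rem2) = 6 * sq_rem2 + 12 * mean_rem1^2 * [:0,1:]"
  unfolding poly_defs by (simp add: pderiv_pCons power2_eq_square power3_eq_cube numeral_poly one_pCons)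

lemma compl_poly_leaf_sizes: "compl_poly [:2, -3, 1:] = leaf_sizes"
proof -
  have "[:2, -3, 1:] = (2 - 3 * [:0, 1:] + [:0, 1::real:] ^ 2)"
    by (simp add: numeral_poly power2_eq_square)
  then have "compl_poly [:2, -3, 1:] = 2 - 3 * (1 - fps_X) + (1 - fps_X) ^ 2"
    by (simp only: compl_poly_hom compl_poly_linear compl_poly_numeral)
  then show ?thesis by (simp add: leaf_sizes_def algebra_simps power2_eq_square)
qed

lemma mean_rem_gf_nth: "mean_rem_gf $ 0 = 293 / 700" "mean_rem_gf $ 1 = 59 / 175" "mean_rem_gf $ 2 = 179 / 700"
  by (simp_all add: mean_rem_gf_def logpoly_nth[unfolded One_nat_def] logpoly_nth poly_defs pderiv_pCons)

lemma second_moment_gf_nth: "second_moment_gf $ 0 = (293 / 700)\<^sup>2" "second_moment_gf $ 1 = (59 / 175)\<^sup>2" "second_moment_gf $ 2 = (179 / 700)\<^sup>2"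
  by (simp_all add: second_moment_gf_def sq_rem_gf_def logpoly_nth[unfolded One_nat_def] logpoly_nth(3)[unfolded numeral_2_eq_2] poly_defs pderiv_pCons var_rate_def
      geo_def power2_eq_square fps_mult_nth numeral_2_eq_2)

text \<open>
  The term \<open>- 1\<close> corrects the coefficient at \<open>N = 0\<close>, where all groups are empty but the root is a
  leaf and not protected. The equation is checked after multiplication by \<open>D\<^sup>2\<close>, with \<open>geo = 1 / D\<close>.
\<close>
lemma mean_rem_gf_ode:
  "fps_deriv (fps_deriv mean_rem_gf) = 2 * ((geo - leaf_sizes) ^ 3 - geo ^ 3 + 3 * mean_rem_gf * geo ^ 2 - 1)"
proof -
  define D :: "real fps" where "D = 1 - fps_X"
  have GD: "geo * D = 1" by (simp add: D_def geo_mult)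
  have "D ^ 2 * fps_deriv (fps_deriv mean_rem_gf) =
      6 * mean_rem_gf - 6 * leaf_sizes + 6 * D * leaf_sizes ^ 2 - 2 * D ^ 2 * leaf_sizes ^ 3 - 2 * D ^ 2"
    unfolding D_def mean_rem_gf_def logpoly_euler
    unfolding pderiv_0 mult_zero_right diff_0_right add_0_right mean_rem_eq0 mean_rem_eq1
    unfolding logpoly_def
      compl_poly_hom compl_poly_linear compl_poly_leaf_sizes compl_poly_const compl_poly_1 compl_poly_0 compl_poly_numeral
    by (simp add: algebra_simps power2_eq_square)
  also have "\<dots> = 6 * (geo * D)^2 * mean_rem_gf - 6 * (geo * D)^2 * leaf_sizes + 6 * D * (geo * D) * leaf_sizes ^ 2
       - 2 * D ^ 2 * leaf_sizes ^ 3 - 2 * D ^ 2"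
    by (simp add: GD)
  also have "\<dots> = D ^ 2 * (2 * ((geo - leaf_sizes) ^ 3 - geo ^ 3 + 3 * mean_rem_gf * geo ^ 2 - 1))"
    by (simp add: algebra_simps power2_eq_square power3_eq_cube)
  finally have "(geo * D)^2 * fps_deriv (fps_deriv mean_rem_gf) =
     (geo * D)^2 * (2 * ((geo - leaf_sizes) ^ 3 - geo ^ 3 + 3 * mean_rem_gf * geo ^ 2 - 1))"
    by (simp only: power_mult_distrib mult.assoc)
  then show ?thesis by (simp add: GD)
qed

text \<open>
  For the centred count \<open>Y\<close>, with mean \<open>y\<close>, this is the recursion of the second moment that comes
  from squaring \<open>(\<tau> - 1) + Y\<^sub>i + Y\<^sub>j + Y\<^sub>k\<close>, where \<open>\<tau>\<close> is the toll: \<open>geo\<^sup>3 - (geo - leaf_sizes)\<^sup>3\<close> comes from \<open>(\<tau> - 1)\<^sup>2 = 1 - \<tau>\<close>, the term with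
  \<open>mean_rem_gf\<^sup>2\<close> from the products of two different subtrees, and the two terms after it from the
  products with \<open>\<tau> - 1\<close>. At \<open>N = 0\<close> the true square is \<open>(3 y\<^sub>0 - 1)\<^sup>2\<close> and not \<open>(3 y\<^sub>0)\<^sup>2\<close>; the constant
  \<open>1 - 6 y\<^sub>0\<close> is the difference, with \<open>y\<^sub>0 = 293/700\<close>.

  Multiplied by \<open>D\<^sup>2\<close>, the equation for \<open>sq_rem_gf\<close> splits into the three identities \<open>sq_rem_eq0\<close>, \<open>sq_rem_eq1\<close>
  and \<open>sq_rem_eq2\<close>. The main term \<open>var_rate * geo\<^sup>2\<close> solves the homogeneous equation, so adding it to
  \<open>sq_rem_gf\<close> preserves the equation.
\<close>
lemma second_moment_gf_ode:
  "fps_deriv (fps_deriv second_moment_gf) = 2 * (geo ^ 3 - (geo - leaf_sizes) ^ 3 + 3 * second_moment_gf * geo ^ 2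
     + 6 * mean_rem_gf ^ 2 * geo - 6 * mean_rem_gf * geo ^ 2 + 6 * no_leaf_mean_gf * (geo - leaf_sizes) ^ 2
     + fps_const (1 - 6 * 293 / 700))"
proof -
  define D :: "real fps" where "D = 1 - fps_X"
  have GD: "geo * D = 1" by (simp add: D_def geo_mult)
  have X: "fps_X = 1 - D" by (simp add: D_def)
  have "D ^ 2 * fps_deriv (fps_deriv sq_rem_gf) =
      6 * sq_rem_gf + 6 * leaf_sizes - 6 * D * leaf_sizes ^ 2 + 2 * D ^ 2 * leaf_sizes ^ 3
      + 12 * mean_rem_gf ^ 2 * D - 12 * mean_rem_gf + 12 * no_leaf_mean_gf * (1 - D * leaf_sizes) ^ 2
      + 2 * fps_const (1 - 6 * 293 / 700) * D ^ 2"
    unfolding D_def sq_rem_gf_def no_leaf_mean_gf_def mean_rem_gf_def logpoly_euler sq_rem_eq0 sq_rem_eq1 sq_rem_eq2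
    unfolding logpoly_def
      compl_poly_hom compl_poly_linear compl_poly_leaf_sizes compl_poly_const compl_poly_1 compl_poly_0 compl_poly_numeral
    by (simp add: algebra_simps power2_eq_square)
  also have "\<dots> = 6 * (geo * D)^2 * sq_rem_gf + 6 * (geo * D)^2 * leaf_sizes - 6 * (geo * D) * D * leaf_sizes ^ 2
      + 2 * D ^ 2 * leaf_sizes ^ 3
      + 12 * mean_rem_gf ^ 2 * (geo * D) * D - 12 * (geo * D)^2 * mean_rem_gf + 12 * no_leaf_mean_gf * ((geo * D) - D * leaf_sizes) ^ 2
      + 2 * fps_const (1 - 6 * 293 / 700) * D ^ 2"
    by (simp add: GD)
  also have "\<dots> = D ^ 2 * (2 * (geo ^ 3 - (geo - leaf_sizes) ^ 3 + 3 * sq_rem_gf * geo ^ 2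
     + 6 * mean_rem_gf ^ 2 * geo - 6 * mean_rem_gf * geo ^ 2 + 6 * no_leaf_mean_gf * (geo - leaf_sizes) ^ 2
     + fps_const (1 - 6 * 293 / 700)))"
    by (simp add: algebra_simps power2_eq_square power3_eq_cube)
  finally have "(geo * D)^2 * fps_deriv (fps_deriv sq_rem_gf) = (geo * D)^2 * (2 * (geo ^ 3 - (geo - leaf_sizes) ^ 3 + 3 * sq_rem_gf * geo ^ 2
     + 6 * mean_rem_gf ^ 2 * geo - 6 * mean_rem_gf * geo ^ 2 + 6 * no_leaf_mean_gf * (geo - leaf_sizes) ^ 2
     + fps_const (1 - 6 * 293 / 700)))"
    by (simp only: power_mult_distrib mult.assoc)
  then have *: "fps_deriv (fps_deriv sq_rem_gf) = 2 * (geo ^ 3 - (geo - leaf_sizes) ^ 3 + 3 * sq_rem_gf * geo ^ 2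
     + 6 * mean_rem_gf ^ 2 * geo - 6 * mean_rem_gf * geo ^ 2 + 6 * no_leaf_mean_gf * (geo - leaf_sizes) ^ 2
     + fps_const (1 - 6 * 293 / 700))" by (simp add: GD)
  have "fps_deriv (fps_deriv (geo ^ 2)) = 6 * geo ^ 4"
    by (simp add: fps_deriv_geo power2_eq_square algebra_simps power4_eq_xxxx)
  then have "fps_deriv (fps_deriv second_moment_gf) = fps_const var_rate * (6 * geo ^ 4) + fps_deriv (fps_deriv sq_rem_gf)"
    by (simp add: second_moment_gf_def)
  also have "\<dots> = 2 * (geo ^ 3 - (geo - leaf_sizes) ^ 3 + 3 * second_moment_gf * geo ^ 2
     + 6 * mean_rem_gf ^ 2 * geo - 6 * mean_rem_gf * geo ^ 2 + 6 * no_leaf_mean_gf * (geo - leaf_sizes) ^ 2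
     + fps_const (1 - 6 * 293 / 700))"
    unfolding * second_moment_gf_def by (simp add: algebra_simps power2_eq_square power4_eq_xxxx)
  finally show ?thesis .
qed

lemma no_leaf_nth: "(geo - leaf_sizes) $ i = (if i \<in> {1, 2} then 0 else 1)"
  by (auto simp: leaf_sizes_def fps_X_power_nth)

lemma split_toll_eq:
  "split_toll i j k = (geo - leaf_sizes) $ i * (geo - leaf_sizes) $ j * (geo - leaf_sizes) $ k"
  unfolding split_toll_def no_leaf_nth by auto

lemma no_leaf_mean_gf_nth: "no_leaf_mean_gf $ i = mean_rem_gf $ i * (geo - leaf_sizes) $ i"
  using mean_rem_gf_nth unfolding no_leaf_nth no_leaf_mean_gf_def
  by (auto simp: fps_X_power_nth numeral_2_eq_2)

lemma mean_rem_gf_bounded: "\<exists>C. \<forall>n. \<bar>mean_rem_gf $ n\<bar> \<le> C"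
  unfolding mean_rem_gf_def by (rule logpoly_bounded)

section \<open>Recursions for the mean and the variance\<close>

definition mean_seq :: "nat \<Rightarrow> real" where
  "mean_seq n = mean_rate * (real n + 1) - 1 / 2 + mean_rem_gf $ n"

definition var_seq :: "nat \<Rightarrow> real" where
  "var_seq n = second_moment_gf $ n - (mean_rem_gf $ n)\<^sup>2"

lemma second_moment_gf_nth_eq: "second_moment_gf $ n = var_rate * (real n + 1) + sq_rem_gf $ n"
  by (simp add: second_moment_gf_def geo_pow2_nth)

lemma mean_seq_small: "n < 3 \<Longrightarrow> mean_seq n = 0"
  using mean_rem_gf_nth by (auto simp: mean_seq_def mean_rate_def numeral_3_eq_3 less_Suc_eq numeral_2_eq_2)

lemma var_seq_small: "n < 3 \<Longrightarrow> var_seq n = 0"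
  by (auto simp: var_seq_def mean_rem_gf_nth[unfolded One_nat_def numeral_2_eq_2] second_moment_gf_nth[unfolded One_nat_def numeral_2_eq_2]
        numeral_3_eq_3 less_Suc_eq power2_eq_square)

text \<open>
  The linear parts of the means cancel since \<open>(i + 1) + (j + 1) + (k + 1) = (N + 2) + 1\<close>, and three
  halves minus one half leave the 1. The same cancellation makes the tolls bounded.
\<close>
lemma centred_toll_eq:
  assumes "i + j + k = N"
  shows "split_toll i j k + mean_seq i + mean_seq j + mean_seq k - mean_seq (N + 2) =
    split_toll i j k - 1 + mean_rem_gf $ i + mean_rem_gf $ j + mean_rem_gf $ k - mean_rem_gf $ (N + 2)"
  using assms[symmetric] by (simp add: mean_seq_def algebra_simps)

lemma sum_splits_mean_rem:
  assumes "N > 0"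
  shows "sum_splits N (\<lambda>i j k. split_toll i j k - 1 + mean_rem_gf $ i + mean_rem_gf $ j + mean_rem_gf $ k) =
    num_splits N * mean_rem_gf $ (N + 2)"
proof -
  define p where "p = geo - leaf_sizes"
  have "sum_splits N (\<lambda>i j k. split_toll i j k - 1 + mean_rem_gf $ i + mean_rem_gf $ j + mean_rem_gf $ k) =
    sum_splits N (\<lambda>i j k. p $ i * p $ j * p $ k - geo $ i * geo $ j * geo $ k
      + mean_rem_gf $ i * geo $ j * geo $ k + geo $ i * mean_rem_gf $ j * geo $ k + geo $ i * geo $ j * mean_rem_gf $ k)"
    unfolding split_toll_eq p_def by simp
  also have "\<dots> = (p * p * p - geo * geo * geo + mean_rem_gf * geo * geo + geo * mean_rem_gf * geo
      + geo * geo * mean_rem_gf) $ N"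
    by (simp only: sum_splits_add sum_splits_diff sum_splits_fps fps_add_nth fps_sub_nth)
  also have "\<dots> = (p ^ 3 - geo ^ 3 + 3 * mean_rem_gf * geo ^ 2 - 1) $ N"
  proof -
    have "p * p * p - geo * geo * geo + mean_rem_gf * geo * geo + geo * mean_rem_gf * geo
      + geo * geo * mean_rem_gf = (p ^ 3 - geo ^ 3 + 3 * mean_rem_gf * geo ^ 2 - 1) + 1"
      by (simp add: power2_eq_square power3_eq_cube algebra_simps)
    then show ?thesis unfolding fps_add_nth[of _ 1] using assms by simp
  qed
  also have "\<dots> = fps_deriv (fps_deriv mean_rem_gf) $ N / 2"
    unfolding mean_rem_gf_ode p_def[symmetric] mult_2 fps_add_nth by simp
  finally show ?thesis by (simp only: fps_deriv2_nth)
qed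

lemma sum_splits_mean:
  assumes "N > 0"
  shows "sum_splits N (\<lambda>i j k. split_toll i j k + mean_seq i + mean_seq j + mean_seq k - mean_seq (N + 2)) = 0"
proof -
  have "sum_splits N (\<lambda>i j k. split_toll i j k + mean_seq i + mean_seq j + mean_seq k - mean_seq (N + 2))
     = sum_splits N (\<lambda>i j k. split_toll i j k - 1 + mean_rem_gf $ i + mean_rem_gf $ j + mean_rem_gf $ k - mean_rem_gf $ (N + 2))"
    by (intro sum_splits_cong centred_toll_eq)
  also have "\<dots> = 0"
    using sum_splits_diff[of N "\<lambda>i j k. split_toll i j k - 1 + mean_rem_gf $ i + mean_rem_gf $ j + mean_rem_gf $ k" "\<lambda>_ _ _. mean_rem_gf $ (N + 2)"]
      sum_splits_mean_rem[OF assms] by (simp add: sum_splits_const)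
  finally show ?thesis .
qed

text \<open>
  Expanding the square, with the toll equal to its own square, gives products of one factor
  for each of \<open>i\<close>, \<open>j\<close> and \<open>k\<close>; these are the coefficients of products of generating functions.
\<close>
lemma sum_splits_second_moment:
  assumes "N > 0"
  shows "sum_splits N (\<lambda>i j k. (split_toll i j k - 1 + mean_rem_gf $ i + mean_rem_gf $ j + mean_rem_gf $ k)\<^sup>2
           + var_seq i + var_seq j + var_seq k) =
    num_splits N * second_moment_gf $ (N + 2)"
proof -
  define p where "p = geo - leaf_sizes"
  let ?y = mean_rem_gf and ?q = second_moment_gf and ?w = no_leaf_mean_gf
  have "(split_toll i j k - 1 + ?y $ i + ?y $ j + ?y $ k)\<^sup>2 + var_seq i + var_seq j + var_seq k =
      geo $ i * geo $ j * geo $ k - p $ i * p $ j * p $ k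
      + ?q $ i * geo $ j * geo $ k + geo $ i * ?q $ j * geo $ k + geo $ i * geo $ j * ?q $ k
      + 2 * (?y $ i * ?y $ j * geo $ k) + 2 * (?y $ i * geo $ j * ?y $ k) + 2 * (geo $ i * ?y $ j * ?y $ k)
      - 2 * (?y $ i * geo $ j * geo $ k) - 2 * (geo $ i * ?y $ j * geo $ k) - 2 * (geo $ i * geo $ j * ?y $ k)
      + 2 * (?w $ i * p $ j * p $ k) + 2 * (p $ i * ?w $ j * p $ k) + 2 * (p $ i * p $ j * ?w $ k)" for i j k
  proof -
    have "split_toll i j k = 0 \<or> split_toll i j k = 1"
      by (auto simp: split_toll_def)
    then have sq: "split_toll i j k * split_toll i j k = split_toll i j k"
      by auto
    have w: "?w $ i * p $ j * p $ k = ?y $ i * split_toll i j k"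
            "p $ i * ?w $ j * p $ k = ?y $ j * split_toll i j k"
            "p $ i * p $ j * ?w $ k = ?y $ k * split_toll i j k"
      unfolding split_toll_eq no_leaf_mean_gf_nth p_def[symmetric] by (simp_all only: ac_simps)
    show ?thesis
      unfolding w split_toll_eq[folded p_def, symmetric] var_seq_def geo_nth
      using sq by (simp add: power2_eq_square algebra_simps)
  qed
  then have "sum_splits N (\<lambda>i j k. (split_toll i j k - 1 + ?y $ i + ?y $ j + ?y $ k)\<^sup>2
           + var_seq i + var_seq j + var_seq k) =
     (geo * geo * geo - p * p * p + ?q * geo * geo + geo * ?q * geo + geo * geo * ?q) $ N
     + 2 * (?y * ?y * geo) $ N + 2 * (?y * geo * ?y) $ N + 2 * (geo * ?y * ?y) $ N
     - 2 * (?y * geo * geo) $ N - 2 * (geo * ?y * geo) $ N - 2 * (geo * geo * ?y) $ N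
     + 2 * (?w * p * p) $ N + 2 * (p * ?w * p) $ N + 2 * (p * p * ?w) $ N"
    unfolding fps_add_nth fps_sub_nth
    by (simp only: sum_splits_add sum_splits_diff sum_splits_cmult sum_splits_fps)
  also have "\<dots> = (geo ^ 3 - p ^ 3 + 3 * ?q * geo ^ 2 + 6 * ?y ^ 2 * geo - 6 * ?y * geo ^ 2 + 6 * ?w * p ^ 2) $ N"
  proof -
    have num: "(3 * f) $ N = 3 * f $ N" "(6 * f) $ N = 6 * f $ N" for f :: "real fps"
      by (simp_all add: numeral_fps_const)
    have "?y * geo * ?y = ?y * ?y * geo" "geo * ?y * ?y = ?y * ?y * geo" "geo * ?y * geo = ?y * geo * geo"
       "geo * geo * ?y = ?y * geo * geo" "p * ?w * p = ?w * p * p" "p * p * ?w = ?w * p * p"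
       "geo * ?q * geo = ?q * geo * geo" "geo * geo * ?q = ?q * geo * geo"
      by (simp_all only: ac_simps)
    then show ?thesis
      unfolding power2_eq_square power3_eq_cube fps_add_nth fps_sub_nth mult.assoc num by (simp only:)
  qed
  also have "\<dots> = (geo ^ 3 - p ^ 3 + 3 * ?q * geo ^ 2 + 6 * ?y ^ 2 * geo - 6 * ?y * geo ^ 2 + 6 * ?w * p ^ 2
      + fps_const (1 - 6 * 293 / 700)) $ N"
    using assms by simp
  also have "\<dots> = fps_deriv (fps_deriv second_moment_gf) $ N / 2"
    unfolding second_moment_gf_ode p_def[symmetric] mult_2 fps_add_nth by simp
  finally show ?thesis by (simp only: fps_deriv2_nth)
qed

lemma sum_splits_var:
  assumes "N > 0"
  shows "sum_splits N (\<lambda>i j k. (split_toll i j k + mean_seq i + mean_seq j + mean_seq k - mean_seq (N + 2))\<^sup>2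
           + (var_seq i + var_seq j + var_seq k - var_seq (N + 2))) = 0"
proof -
  let ?b = "\<lambda>i j k. split_toll i j k - 1 + mean_rem_gf $ i + mean_rem_gf $ j + mean_rem_gf $ k" and ?m = "mean_rem_gf $ (N + 2)"
  have "sum_splits N (\<lambda>i j k. (split_toll i j k + mean_seq i + mean_seq j + mean_seq k - mean_seq (N + 2))\<^sup>2
           + (var_seq i + var_seq j + var_seq k - var_seq (N + 2)))
      = sum_splits N (\<lambda>i j k. ((?b i j k)\<^sup>2 + var_seq i + var_seq j + var_seq k)
          - (2 * ?m) * ?b i j k + (?m\<^sup>2 - var_seq (N + 2)))"
  proof (intro sum_splits_cong)
    fix i j k assume "i + j + k = N"
    note toll = centred_toll_eq[OF this]
    show "(split_toll i j k + mean_seq i + mean_seq j + mean_seq k - mean_seq (N + 2))\<^sup>2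
           + (var_seq i + var_seq j + var_seq k - var_seq (N + 2))
      = ((?b i j k)\<^sup>2 + var_seq i + var_seq j + var_seq k) - (2 * ?m) * ?b i j k + (?m\<^sup>2 - var_seq (N + 2))"
      unfolding toll by (simp add: power2_eq_square algebra_simps)
  qed
  also have "\<dots> = num_splits N * second_moment_gf $ (N + 2) - 2 * ?m * (num_splits N * ?m) + num_splits N * (?m\<^sup>2 - var_seq (N + 2))"
    by (simp only: sum_splits_add[of N "\<lambda>i j k. _ i j k - _ i j k" "\<lambda>_ _ _. _"] sum_splits_diff sum_splits_cmult sum_splits_const sum_splits_second_moment[OF assms] sum_splits_mean_rem[OF assms] right_diff_distrib)
  also have "\<dots> = 0"
    by (simp add: var_seq_def power2_eq_square algebra_simps)
  finally show ?thesis .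
qed

lemma var_seq_bounded: "\<exists>C. \<forall>n. \<bar>var_seq n - var_rate * (real n + 1)\<bar> \<le> C"
proof -
  obtain B C where B: "\<And>n. \<bar>mean_rem_gf $ n\<bar> \<le> B" and C: "\<And>n. \<bar>sq_rem_gf $ n\<bar> \<le> C"
    using mean_rem_gf_bounded logpoly_bounded unfolding sq_rem_gf_def by metis
  have "\<bar>var_seq n - var_rate * (real n + 1)\<bar> \<le> C + B\<^sup>2" for n
  proof -
    have "(mean_rem_gf $ n)\<^sup>2 \<le> B\<^sup>2"
      using B[of n] by (simp add: abs_le_square_iff[symmetric])
    moreover have "(mean_rem_gf $ n)\<^sup>2 \<ge> 0" by simp
    ultimately show ?thesis
      using C[of n] unfolding var_seq_def second_moment_gf_nth_eq by linarith
  qed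
  then show ?thesis by blast
qed

lemma toll_bounded:
  "\<exists>C. \<forall>i j k. \<bar>split_toll i j k + mean_seq i + mean_seq j + mean_seq k - mean_seq (i + j + k + 2)\<bar> \<le> C
     \<and> \<bar>var_seq i + var_seq j + var_seq k - var_seq (i + j + k + 2)\<bar> \<le> C"
proof -
  obtain B C where B: "\<And>n. \<bar>mean_rem_gf $ n\<bar> \<le> B"
      and C: "\<And>n. \<bar>var_seq n - var_rate * (real n + 1)\<bar> \<le> C"
    using mean_rem_gf_bounded var_seq_bounded by metis
  have 1: "\<bar>split_toll i j k + mean_seq i + mean_seq j + mean_seq k - mean_seq (i + j + k + 2)\<bar> \<le> 1 + 4 * B" for i j k
    using B[of i] B[of j] B[of k] B[of "i + j + k + 2"] unfolding centred_toll_eq[OF refl]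
    by (auto simp: split_toll_def)
  have 2: "\<bar>var_seq i + var_seq j + var_seq k - var_seq (i + j + k + 2)\<bar> \<le> 4 * C" for i j k
    using C[of i] C[of j] C[of k] C[of "i + j + k + 2"] by (simp add: algebra_simps)
  show ?thesis
    by (rule exI[of _ "max (1 + 4 * B) (4 * C)"]) (use 1 2 in \<open>auto simp: le_max_iff_disj\<close>)
qed

lemma prot_char_gaussian:
  "\<exists>C. \<forall>n t. \<bar>t\<bar> \<le> 1 \<longrightarrow>
    norm (prot_char n t - exp (\<i> * of_real (t * mean_seq n) - of_real (t\<^sup>2 * var_seq n / 2))) \<le> C * real n * \<bar>t\<bar> ^ 3"
proof -
  obtain K where "\<And>i j k. \<bar>split_toll i j k + mean_seq i + mean_seq j + mean_seq k - mean_seq (i + j + k + 2)\<bar> \<le> K"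
     "\<And>i j k. \<bar>var_seq i + var_seq j + var_seq k - var_seq (i + j + k + 2)\<bar> \<le> K"
    using toll_bounded by metis
  moreover have "sum_splits N (\<lambda>i j k. split_toll i j k + mean_seq i + mean_seq j + mean_seq k - mean_seq (i + j + k + 2)) = 0"
    if "N > 0" for N
    using sum_splits_mean[OF that] by (subst sum_splits_cong) auto
  moreover have "sum_splits N (\<lambda>i j k. (split_toll i j k + mean_seq i + mean_seq j + mean_seq k - mean_seq (i + j + k + 2))\<^sup>2
      + (var_seq i + var_seq j + var_seq k - var_seq (i + j + k + 2))) = 0"
    if "N > 0" for N
    using sum_splits_var[OF that] by (subst sum_splits_cong) auto
  moreover have "sum_splits N (\<lambda>i j k. iexp (t * split_toll i j k) * (prot_char i t * prot_char j t * prot_char k t)) =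
      of_real (num_splits N) * prot_char (N + 2) t" if "N > 0" for N and t :: real
    using that by (rule prot_char_rec)
  ultimately show ?thesis
    by (intro gaussian_approximation prot_char_small mean_seq_small var_seq_small norm_prot_char_le) assumption
qed

section \<open>From independent uniform keys to random permutations\<close>

lemma measurable_map_list_countable:
  fixes f :: "'i \<Rightarrow> 'a \<Rightarrow> 'b::countable"
  assumes "\<And>i. i \<in> set is \<Longrightarrow> f i \<in> M \<rightarrow>\<^sub>M count_space UNIV"
  shows "(\<lambda>x. map (\<lambda>i. f i x) is) \<in> M \<rightarrow>\<^sub>M count_space UNIV"
  using assms
proof (induction "is")
  case (Cons i "is")
  have "(\<lambda>x. v # map (\<lambda>i. f i x) is) \<in> M \<rightarrow>\<^sub>M count_space UNIV" for v
    using Cons by (intro measurable_compose[OF Cons.IH measurable_count_space]) auto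
  then have "(\<lambda>x. f i x # map (\<lambda>i. f i x) is) \<in> M \<rightarrow>\<^sub>M count_space UNIV"
    by (rule measurable_compose_countable[where g = "f i"]) (use Cons in auto)
  then show ?case by simp
qed simp

text \<open>
  Replacing each key by its rank preserves the order, hence the count. The ranks take
  finitely many values and are measurable, which gives the measurability of the count.
\<close>
lemma prot_count_eq_ranks:
  fixes x :: "nat \<Rightarrow> real"
  shows "prot_count (map x [0..<n]) = prot_count (map (\<lambda>i. \<Sum>j<n. if x j < x i then 1 else 0 :: nat) [0..<n])"
proof -
  define r where "r u = (\<Sum>j<n. if x j < u then 1 else 0 :: nat)" for u
  have "strict_mono_on (set (map x [0..<n])) r"
  proof (rule strict_mono_onI)
    fix u w assume *: "u \<in> set (map x [0..<n])" "u < w"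
    then obtain j where j: "j < n" "u = x j" by auto
    show "r u < r w"
      unfolding r_def
      by (rule sum_strict_mono_ex1) (use * j in \<open>auto intro!: bexI[of _ j]\<close>)
  qed
  from prot_count_map[OF this] show ?thesis
    by (simp add: r_def o_def)
qed

lemma measurable_prot_count:
  "(\<lambda>x. prot_count (map x [0..<n])) \<in> PiM {..<n} (\<lambda>_. borel :: real measure) \<rightarrow>\<^sub>M count_space UNIV"
proof -
  have "(\<lambda>x. \<Sum>j<n. if x j < x i then 1 else 0 :: nat) \<in> PiM {..<n} (\<lambda>_. borel :: real measure) \<rightarrow>\<^sub>M count_space UNIV"
    if i: "i < n" for i
  proof -
    have [measurable]: "(\<lambda>x. x j) \<in> PiM {..<n} (\<lambda>_. borel :: real measure) \<rightarrow>\<^sub>M borel" if "j < n" for j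
      using that by (intro measurable_component_singleton) auto
    note [measurable] = this[OF i]
    show ?thesis
    proof (rule borel_measurable_sum[THEN measurable_cong_sets[OF refl sets_borel_eq_count_space, THEN equalityD1, THEN subsetD]])
      fix j assume "j \<in> {..<n}"
      then have [measurable]: "(\<lambda>x. x j) \<in> PiM {..<n} (\<lambda>_. borel :: real measure) \<rightarrow>\<^sub>M borel" by simp
      show "(\<lambda>x. if x j < x i then 1 else 0 :: nat) \<in> borel_measurable (PiM {..<n} (\<lambda>_. borel :: real measure))"
        by measurable
    qed
  qed
  then have "(\<lambda>x. map (\<lambda>i. \<Sum>j<n. if x j < x i then 1 else 0 :: nat) [0..<n]) \<in> PiM {..<n} (\<lambda>_. borel :: real measure) \<rightarrow>\<^sub>M count_space UNIV"
    by (intro measurable_map_list_countable) auto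
  from measurable_compose[OF this measurable_count_space, of prot_count] show ?thesis
    by (subst prot_count_eq_ranks)
qed

lemma (in prob_space) AE_distinct_iid:
  fixes X :: "nat \<Rightarrow> 'a \<Rightarrow> real"
  assumes indep: "indep_vars (\<lambda>_. borel) X UNIV"
    and unif: "\<And>i. distr M borel (X i) = uniform_measure lborel {0..1}"
    and "i \<noteq> j"
  shows "AE \<omega> in M. X i \<omega> \<noteq> X j \<omega>"
proof -
  let ?U = "uniform_measure lborel {0..1::real}"
  have [measurable]: "X i \<in> borel_measurable M" for i
    using indep by (auto simp: indep_vars_def)
  interpret U: prob_space ?U
    by (rule prob_space_uniform_measure) auto
  interpret UU: pair_sigma_finite ?U ?U ..
  have "indep_var (PiM {i} (\<lambda>_. borel)) (\<lambda>\<omega>. restrict (\<lambda>i. X i \<omega>) {i}) (PiM {j} (\<lambda>_. borel)) (\<lambda>\<omega>. restrict (\<lambda>i. X i \<omega>) {j})"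
    using \<open>i \<noteq> j\<close> by (intro indep_var_restrict[OF indep]) auto
  from indep_var_compose[OF this, of "\<lambda>f. f i" borel "\<lambda>f. f j" borel]
  have "indep_var borel (X i) borel (X j)"
    by (simp add: o_def)
  then have eq: "distr M (borel \<Otimes>\<^sub>M borel) (\<lambda>x. (X i x, X j x)) = ?U \<Otimes>\<^sub>M ?U"
    using unif by (simp add: indep_var_distribution_eq)
  have "AE x in ?U. AE y in ?U. fst (x, y) \<noteq> snd (x, y)"
  proof (rule AE_I2)
    fix x
    have "AE y in lborel. y \<noteq> (x::real)" by (rule AE_lborel_singleton)
    then show "AE y in ?U. fst (x, y) \<noteq> snd (x, y)"
      by (intro AE_uniform_measureI) auto
  qed
  then have "AE z in ?U \<Otimes>\<^sub>M ?U. fst z \<noteq> snd z"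
    by (intro UU.AE_pair_measure) measurable
  then have "AE z in distr M (borel \<Otimes>\<^sub>M borel) (\<lambda>x. (X i x, X j x)). fst z \<noteq> snd z"
    by (simp only: eq)
  then show ?thesis
    by (subst (asm) AE_distr_iff) auto
qed

text \<open>
  The joint law of the keys is invariant under permutations of the indices, so the
  expectation may be averaged over all orders of arrival. For fixed distinct keys this
  average is one over the permutations of a set with \<open>n\<close> elements.
\<close>
lemma (in prob_space) char_prot_count_iid:
  fixes X :: "nat \<Rightarrow> 'a \<Rightarrow> real"
  assumes indep: "indep_vars (\<lambda>_. borel) X UNIV"
    and unif: "\<And>i. distr M borel (X i) = uniform_measure lborel {0..1}"
  shows "expectation (\<lambda>\<omega>. iexp (t * real (prot_count (map (\<lambda>i. X i \<omega>) [0..<n])))) = prot_char n t"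
proof (cases "n = 0")
  case True
  then show ?thesis
    by (simp add: prot_char_small prot_count_short prob_space)
next
  case False
  let ?U = "uniform_measure lborel {0..1::real}" and ?B = "PiM {..<n} (\<lambda>_. borel :: real measure)"
  let ?P = "PiM {..<n} (\<lambda>_. ?U)"
  define e where "e xs = iexp (t * real (prot_count xs))" for xs :: "real list"
  have X[measurable]: "X i \<in> borel_measurable M" for i
    using indep by (auto simp: indep_vars_def)
  have joint: "distr M ?B (\<lambda>\<omega>. \<lambda>i\<in>{..<n}. X i \<omega>) = ?P"
    using indep_vars_iff_distr_eq_PiM[where I = "{..<n}" and M' = "\<lambda>_. borel" and X = X] indep_vars_subset[OF indep, of "{..<n}"] False
    by (simp add: unif lessThan_empty_iff)
  have sets_P: "sets ?P = sets ?B"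
    by (intro sets_PiM_cong) auto
  have meas_e: "(\<lambda>x. e (map x [0..<n])) \<in> borel_measurable ?B"
    unfolding e_def by (rule measurable_compose[OF measurable_prot_count measurable_count_space, THEN measurable_compose]) simp
  have exch: "expectation (\<lambda>\<omega>. e (map (\<lambda>i. X i \<omega>) \<sigma>)) = (\<integral>x. e (map x [0..<n]) \<partial>?P)"
    and int: "integrable M (\<lambda>\<omega>. e (map (\<lambda>i. X i \<omega>) \<sigma>))"
    if \<sigma>: "\<sigma> \<in> permutations_of_set {..<n}" for \<sigma>
  proof -
    have len: "length \<sigma> = n" and set: "set \<sigma> = {..<n}" and dist: "distinct \<sigma>"
      using \<sigma> length_finite_permutations_of_set[OF \<sigma>] by (auto dest: permutations_of_setD)
    have nth: "\<sigma> ! k < n" if "k < n" for k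
      using nth_mem[of k \<sigma>] that len set by auto
    have inj: "inj_on ((!) \<sigma>) {..<n}"
      using dist len by (auto simp: inj_on_def nth_eq_iff_index_eq)
    have sub: "(!) \<sigma> \<in> {..<n} \<rightarrow> {..<n}"
      using nth by auto
    have U: "prob_space ?U" by (rule prob_space_uniform_measure) auto
    have perm: "distr ?P ?P (\<lambda>x. \<lambda>k\<in>{..<n}. x (\<sigma> ! k)) = ?P"
      using distr_PiM_reindex[OF U inj sub] by simp
    have mapeq: "map (\<lambda>i. y i) \<sigma> = map (\<lambda>k\<in>{..<n}. y (\<sigma> ! k)) [0..<n]" for y :: "nat \<Rightarrow> real"
      using len by (intro nth_equalityI) auto
    have mX: "(\<lambda>\<omega>. \<lambda>i\<in>{..<n}. X i \<omega>) \<in> M \<rightarrow>\<^sub>M ?B" by measurable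
    have mperm: "(\<lambda>x. \<lambda>k\<in>{..<n}. x (\<sigma> ! k)) \<in> ?B \<rightarrow>\<^sub>M ?B"
      using nth by (intro measurable_restrict measurable_component_singleton) auto
    have eq: "e (map (\<lambda>i. X i \<omega>) \<sigma>) = e (map (\<lambda>k\<in>{..<n}. (\<lambda>i\<in>{..<n}. X i \<omega>) (\<sigma> ! k)) [0..<n])" for \<omega>
    proof -
      have "map (\<lambda>i. X i \<omega>) \<sigma> = map (\<lambda>i\<in>{..<n}. X i \<omega>) \<sigma>"
        using set by simp
      then show ?thesis using mapeq[of "\<lambda>i\<in>{..<n}. X i \<omega>"] by simp
    qed
    show "integrable M (\<lambda>\<omega>. e (map (\<lambda>i. X i \<omega>) \<sigma>))"
    proof (rule integrable_const_bound[where B = 1])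
      show "(\<lambda>\<omega>. e (map (\<lambda>i. X i \<omega>) \<sigma>)) \<in> borel_measurable M"
        unfolding eq by (rule measurable_compose[OF measurable_compose[OF mX mperm] meas_e])
    qed (simp add: e_def norm_exp_eq_Re)
    have "expectation (\<lambda>\<omega>. e (map (\<lambda>i. X i \<omega>) \<sigma>)) =
       (\<integral>x. e (map (\<lambda>k\<in>{..<n}. x (\<sigma> ! k)) [0..<n]) \<partial>distr M ?B (\<lambda>\<omega>. \<lambda>i\<in>{..<n}. X i \<omega>))"
      unfolding eq by (rule integral_distr[symmetric, OF mX measurable_compose[OF mperm meas_e]])
    also have "\<dots> = (\<integral>x. e (map (\<lambda>k\<in>{..<n}. x (\<sigma> ! k)) [0..<n]) \<partial>?P)"
      by (simp only: joint)
    also have "\<dots> = (\<integral>x. e (map x [0..<n]) \<partial>distr ?P ?P (\<lambda>x. \<lambda>k\<in>{..<n}. x (\<sigma> ! k)))"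
    proof (rule integral_distr[symmetric])
      show "(\<lambda>x. \<lambda>k\<in>{..<n}. x (\<sigma> ! k)) \<in> ?P \<rightarrow>\<^sub>M ?P"
        using mperm measurable_cong_sets[OF sets_P sets_P] by blast
      show "(\<lambda>x. e (map x [0..<n])) \<in> borel_measurable ?P"
        using meas_e measurable_cong_sets[OF sets_P refl] by blast
    qed
    also have "\<dots> = (\<integral>x. e (map x [0..<n]) \<partial>?P)"
      by (simp only: perm)
    finally show "expectation (\<lambda>\<omega>. e (map (\<lambda>i. X i \<omega>) \<sigma>)) = (\<integral>x. e (map x [0..<n]) \<partial>?P)" .
  qed
  have id: "[0..<n] \<in> permutations_of_set {..<n}"
    by (auto intro!: permutations_of_setI)
  have "expectation (\<lambda>\<omega>. e (map (\<lambda>i. X i \<omega>) [0..<n])) =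
     (\<Sum>\<sigma>\<in>permutations_of_set {..<n}. expectation (\<lambda>\<omega>. e (map (\<lambda>i. X i \<omega>) \<sigma>)) /\<^sub>R fact n)"
    by (simp add: exch exch[OF id] card_permutations_of_set scaleR_conv_of_real)
  also have "\<dots> = expectation (\<lambda>\<omega>. \<Sum>\<sigma>\<in>permutations_of_set {..<n}. e (map (\<lambda>i. X i \<omega>) \<sigma>) /\<^sub>R fact n)"
    using int by (subst Bochner_Integration.integral_sum) auto
  also have "\<dots> = expectation (\<lambda>\<omega>. prot_char n t)"
  proof (rule integral_cong_AE)
    have "AE \<omega> in M. \<forall>i\<in>{..<n}. \<forall>j\<in>{..<n}. i \<noteq> j \<longrightarrow> X i \<omega> \<noteq> X j \<omega>"
      using AE_distinct_iid[OF indep unif] by (simp add: AE_ball_countable)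
    then show "AE \<omega> in M. (\<Sum>\<sigma>\<in>permutations_of_set {..<n}. e (map (\<lambda>i. X i \<omega>) \<sigma>) /\<^sub>R fact n) = prot_char n t"
    proof eventually_elim
      case (elim \<omega>)
      define y where "y i = X i \<omega>" for i
      have inj: "inj_on y {..<n}"
        using elim by (auto simp: inj_on_def y_def)
      then have card: "card (y ` {..<n}) = n"
        by (simp add: card_image)
      have "(\<Sum>\<sigma>\<in>permutations_of_set {..<n}. e (map y \<sigma>) /\<^sub>R fact n) =
          (\<Sum>xs\<in>permutations_of_set (y ` {..<n}). e xs /\<^sub>R fact n)"
        unfolding permutations_of_set_image_inj[OF inj]
        by (subst sum.reindex) (auto intro!: inj_on_mapI simp: inj)
      also have "\<dots> = measure_pmf.expectation (random_perm (y ` {..<n})) e"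
        by (simp add: expectation_random_perm_sum card)
      also have "\<dots> = prot_char n t"
        unfolding e_def prot_char_def
        by (subst expectation_random_perm_card) (simp_all add: card)
      finally show ?case by (simp only: y_def[abs_def])
    qed
  qed (use int in auto)
  also have "\<dots> = prot_char n t"
    by (simp add: prob_space)
  finally show ?thesis by (simp add: e_def)
qed

section \<open>The central limit theorem\<close>

lemma char_normal_density:
  assumes "\<sigma> > 0"
  shows "char (density lborel (normal_density 0 \<sigma>)) s = of_real (exp (- (\<sigma>\<^sup>2 * s\<^sup>2 / 2)))"
proof -
  interpret N: prob_space std_normal_distribution
    by (rule prob_space_normal_density) simp
  have "distributed std_normal_distribution lborel (\<lambda>x. x) std_normal_density"
    by (auto simp: distributed_def distr_id2)
  from N.normal_density_affine[OF this, of \<sigma> 0] assms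
  have "distr std_normal_distribution lborel (\<lambda>x. \<sigma> * x) = density lborel (normal_density 0 \<sigma>)"
    by (simp add: distributed_def)
  then have "char (density lborel (normal_density 0 \<sigma>)) s = (\<integral>x. iexp (s * x) \<partial>distr std_normal_distribution lborel (\<lambda>x. \<sigma> * x))"
    by (simp add: char_def)
  also have "\<dots> = char std_normal_distribution (s * \<sigma>)"
    unfolding char_def by (subst integral_distr) (simp_all add: mult.assoc)
  also have "\<dots> = of_real (exp (- (\<sigma>\<^sup>2 * s\<^sup>2 / 2)))"
    by (simp add: char_std_normal_distribution power_mult_distrib mult.commute)
  finally show ?thesis .
qed

lemma LIMSEQ_bounded_over_sqrt:
  assumes "\<And>n. \<bar>f n\<bar> \<le> (C::real)"
  shows "(\<lambda>n. f n / sqrt (real n)) \<longlonglongrightarrow> 0"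
proof (rule Lim_null_comparison)
  show "\<forall>\<^sub>F n in sequentially. norm (f n / sqrt (real n)) \<le> C / sqrt (real n)"
    using assms by (intro always_eventually allI) (simp add: divide_right_mono)
  show "(\<lambda>n. C / sqrt (real n)) \<longlonglongrightarrow> 0"
    by real_asymp
qed

text \<open>
  The difference to the Gaussian is at most \<open>C n |s / \<surd>n|\<^sup>3 = C |s|\<^sup>3 / \<surd>n\<close>. The condition \<open>|t| \<le> 1\<close> of the
  Gaussian approximation is met by \<open>t = s / \<surd>n\<close> as soon as \<open>n \<ge> s\<^sup>2\<close>.
\<close>
lemma prot_char_limit:
  "(\<lambda>n. iexp (- (s * mean_rate * sqrt (real n))) * prot_char n (s / sqrt (real n)))
     \<longlonglongrightarrow> of_real (exp (- (var_rate * s\<^sup>2 / 2)))"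
proof -
  obtain C where C: "\<And>n t. \<bar>t\<bar> \<le> 1 \<Longrightarrow>
    norm (prot_char n t - exp (\<i> * of_real (t * mean_seq n) - of_real (t\<^sup>2 * var_seq n / 2))) \<le> C * real n * \<bar>t\<bar> ^ 3"
    using prot_char_gaussian by blast
  define g where "g n = exp (\<i> * of_real (s / sqrt n * mean_seq n) - of_real ((s / sqrt n)\<^sup>2 * var_seq n / 2))" for n
  define u where "u n = iexp (- (s * mean_rate * sqrt (real n)))" for n
  have norm_u: "norm (u n) = 1" for n
    by (simp add: u_def norm_exp_eq_Re)
  have diff: "(\<lambda>n. u n * (prot_char n (s / sqrt (real n)) - g n)) \<longlonglongrightarrow> 0"
  proof (rule Lim_null_comparison)
    show "\<forall>\<^sub>F n in sequentially. norm (u n * (prot_char n (s / sqrt (real n)) - g n)) \<le> (C * \<bar>s\<bar> ^ 3) / sqrt (real n)"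
    proof (rule eventually_mono[OF eventually_ge_at_top[of "nat \<lceil>s\<^sup>2\<rceil> + 1"]])
      fix n assume n: "n \<ge> nat \<lceil>s\<^sup>2\<rceil> + 1"
      then have pos: "sqrt (real n) > 0" by simp
      have "s\<^sup>2 \<le> real n" using n by linarith
      then have "\<bar>s\<bar> \<le> sqrt (real n)"
        by (metis real_sqrt_abs real_sqrt_le_mono)
      then have "\<bar>s / sqrt (real n)\<bar> \<le> 1"
        using pos by (simp add: abs_divide)
      from C[OF this, of n] have "norm (u n * (prot_char n (s / sqrt (real n)) - g n)) \<le> C * real n * \<bar>s / sqrt (real n)\<bar> ^ 3"
        by (simp add: norm_mult norm_u g_def)
      also have "\<dots> = (C * \<bar>s\<bar> ^ 3) / sqrt (real n)"
      proof -
        have "real n = sqrt (real n) * sqrt (real n)" by simp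
        then have "C * real n * \<bar>s / sqrt (real n)\<bar> ^ 3 = C * (sqrt (real n) * sqrt (real n)) * (\<bar>s\<bar> / sqrt (real n)) ^ 3"
          by (simp add: abs_divide)
        also have "\<dots> = (C * \<bar>s\<bar> ^ 3) / sqrt (real n)"
          using pos by (simp add: power3_eq_cube field_simps del: real_sqrt_mult_self)
        finally show ?thesis .
      qed
      finally show "norm (u n * (prot_char n (s / sqrt (real n)) - g n)) \<le> (C * \<bar>s\<bar> ^ 3) / sqrt (real n)" .
    qed
    show "(\<lambda>n. C * \<bar>s\<bar> ^ 3 / sqrt (real n)) \<longlonglongrightarrow> 0"
      by real_asymp
  qed
  obtain B where B: "\<And>n. \<bar>mean_rem_gf $ n\<bar> \<le> B" using mean_rem_gf_bounded by blast
  obtain V where V: "\<And>n. \<bar>var_seq n - var_rate * (real n + 1)\<bar> \<le> V" using var_seq_bounded by blast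
  have "\<bar>mean_seq n - mean_rate * real n\<bar> \<le> \<bar>mean_rate\<bar> + 1 + B" for n
    using B[of n] by (simp add: mean_seq_def algebra_simps)
  note mean_rem0 = LIMSEQ_bounded_over_sqrt[OF this]
  have "\<bar>var_seq n - var_rate * real n\<bar> \<le> \<bar>var_rate\<bar> + V" for n
    using V[of n] by (simp add: algebra_simps)
  note LIMSEQ_bounded_over_sqrt[OF this]
  moreover have "(\<lambda>n. 1 / sqrt (real n)) \<longlonglongrightarrow> 0" by real_asymp
  ultimately have "(\<lambda>n. (var_seq n - var_rate * real n) / sqrt (real n) * (1 / sqrt (real n)) + var_rate) \<longlonglongrightarrow> 0 * 0 + var_rate"
    by (intro tendsto_intros)
  then have var_lim: "(\<lambda>n. var_seq n / real n) \<longlonglongrightarrow> var_rate"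
  proof (rule tendsto_eq_rhs[OF Lim_transform_eventually])
    show "\<forall>\<^sub>F n in sequentially. (var_seq n - var_rate * real n) / sqrt (real n) * (1 / sqrt (real n)) + var_rate = var_seq n / real n"
      by (rule eventually_mono[OF eventually_gt_at_top[of 0]]) (simp add: field_simps)
  qed simp
  have "(\<lambda>n. exp (\<i> * of_real (s * ((mean_seq n - mean_rate * real n) / sqrt (real n))) - of_real (s\<^sup>2 * (var_seq n / real n) / 2)))
      \<longlonglongrightarrow> exp (\<i> * of_real (s * 0) - of_real (s\<^sup>2 * var_rate / 2))"
    by (intro tendsto_intros mean_rem0 var_lim) auto
  then have ug: "(\<lambda>n. u n * g n) \<longlonglongrightarrow> of_real (exp (- (var_rate * s\<^sup>2 / 2)))"
  proof (rule tendsto_eq_rhs[OF Lim_transform_eventually])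
    show "\<forall>\<^sub>F n in sequentially. exp (\<i> * of_real (s * ((mean_seq n - mean_rate * real n) / sqrt (real n))) - of_real (s\<^sup>2 * (var_seq n / real n) / 2)) = u n * g n"
    proof (rule eventually_mono[OF eventually_gt_at_top[of 0]])
      fix n :: nat assume "n > 0"
      have sq: "real n / sqrt (real n) = sqrt (real n)"
        by (simp add: real_div_sqrt)
      have 1: "s * ((mean_seq n - mean_rate * real n) / sqrt (real n)) = - (s * mean_rate * sqrt (real n)) + s / sqrt (real n) * mean_seq n"
        unfolding diff_divide_distrib times_divide_eq_right[symmetric] sq by (simp add: algebra_simps)
      have 2: "s\<^sup>2 * (var_seq n / real n) / 2 = (s / sqrt (real n))\<^sup>2 * var_seq n / 2"
        by (simp add: power_divide)
      show "exp (\<i> * of_real (s * ((mean_seq n - mean_rate * real n) / sqrt (real n))) - of_real (s\<^sup>2 * (var_seq n / real n) / 2)) = u n * g n"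
        unfolding u_def g_def exp_add[symmetric] 1 2 of_real_add by (rule arg_cong[of _ _ exp]) (simp only: ring_distribs add_diff_eq)
    qed
  qed (simp add: mult.commute flip: exp_of_real)
  from tendsto_add[OF diff ug] show ?thesis
    by (simp add: u_def ring_distribs)
qed

theorem theorem1p1:
  fixes M :: "'a measure" and X :: "nat \<Rightarrow> 'a \<Rightarrow> real" and Z :: "nat \<Rightarrow> 'a \<Rightarrow> nat"
  assumes "prob_space M"
    and "prob_space.indep_vars M (\<lambda>_. borel) X UNIV"
    and "\<And>i. distr M borel (X i) = uniform_measure lborel {0..1}"
    and "\<And>n \<omega>. Z n \<omega> = num_protected (mary_search_tree 3 (map (\<lambda>i. X i \<omega>) [0..<n]))"
  shows "weak_conv_m
           (\<lambda>n. distr M borel (\<lambda>\<omega>. (real (Z n \<omega>) - 57 / 700 * real n) / sqrt (real n)))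
           (density lborel (normal_density 0 (sqrt (1692302314867 / 43692253605000))))"
proof -
  interpret prob_space M by fact
  have Z: "Z n \<omega> = prot_count (map (\<lambda>i. X i \<omega>) [0..<n])" for n \<omega>
    by (simp add: assms(4) prot_count_def)
  have X[measurable]: "X i \<in> borel_measurable M" for i
    using assms(2) by (auto simp: indep_vars_def)
  have Z_meas: "Z n \<in> M \<rightarrow>\<^sub>M count_space UNIV" for n
  proof -
    have "(\<lambda>\<omega>. \<lambda>i\<in>{..<n}. X i \<omega>) \<in> M \<rightarrow>\<^sub>M PiM {..<n} (\<lambda>_. borel)" by measurable
    from measurable_compose[OF this measurable_prot_count]
    have "(\<lambda>\<omega>. prot_count (map (\<lambda>i\<in>{..<n}. X i \<omega>) [0..<n])) \<in> M \<rightarrow>\<^sub>M count_space UNIV" .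
    moreover have "map (\<lambda>i\<in>{..<n}. X i \<omega>) [0..<n] = map (\<lambda>i. X i \<omega>) [0..<n]" for \<omega> by simp
    ultimately show ?thesis by (simp add: Z[abs_def])
  qed
  have meas[measurable]: "(\<lambda>\<omega>. (real (Z n \<omega>) - 57 / 700 * real n) / sqrt (real n)) \<in> borel_measurable M" for n
  proof -
    have "(\<lambda>\<omega>. real (Z n \<omega>)) \<in> borel_measurable M"
      by (rule measurable_compose[OF Z_meas]) simp
    then show ?thesis by measurable
  qed
  show ?thesis
  proof (rule levy_continuity)
    show "real_distribution (distr M borel (\<lambda>\<omega>. (real (Z n \<omega>) - 57 / 700 * real n) / sqrt (real n)))" for n
      by (rule real_distribution_distr) (rule meas)
    show "real_distribution (density lborel (normal_density 0 (sqrt (1692302314867 / 43692253605000))))"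
      by (auto simp: real_distribution_def real_distribution_axioms_def prob_space_normal_density)
    fix s :: real
    have "char (distr M borel (\<lambda>\<omega>. (real (Z n \<omega>) - 57 / 700 * real n) / sqrt (real n))) s =
       iexp (- (s * mean_rate * sqrt (real n))) * prot_char n (s / sqrt (real n))" for n
    proof -
      have sq: "real n / sqrt (real n) = sqrt (real n)"
        by (simp add: real_div_sqrt)
      have "char (distr M borel (\<lambda>\<omega>. (real (Z n \<omega>) - 57 / 700 * real n) / sqrt (real n))) s =
        expectation (\<lambda>\<omega>. iexp (s * ((real (Z n \<omega>) - 57 / 700 * real n) / sqrt (real n))))"
        unfolding char_def by (rule integral_distr[OF meas]) measurable
      also have "\<dots> = expectation (\<lambda>\<omega>. iexp (- (s * mean_rate * sqrt (real n))) * iexp (s / sqrt (real n) * real (Z n \<omega>)))"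
      proof (rule Bochner_Integration.integral_cong[OF refl])
        fix \<omega>
        have "s * ((real (Z n \<omega>) - 57 / 700 * real n) / sqrt (real n)) = - (s * mean_rate * sqrt (real n)) + s / sqrt (real n) * real (Z n \<omega>)"
          unfolding mean_rate_def diff_divide_distrib times_divide_eq_right[symmetric] sq by (simp add: algebra_simps)
        then show "iexp (s * ((real (Z n \<omega>) - 57 / 700 * real n) / sqrt (real n))) =
            iexp (- (s * mean_rate * sqrt (real n))) * iexp (s / sqrt (real n) * real (Z n \<omega>))"
          by (simp only: exp_add[symmetric] of_real_add ring_distribs)
      qed
      also have "\<dots> = iexp (- (s * mean_rate * sqrt (real n))) * prot_char n (s / sqrt (real n))"
        unfolding Z by (simp only: integral_mult_right_zero char_prot_count_iid[OF assms(2,3)])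
      finally show ?thesis .
    qed
    moreover have "char (density lborel (normal_density 0 (sqrt (1692302314867 / 43692253605000)))) s = of_real (exp (- (var_rate * s\<^sup>2 / 2)))"
      by (subst char_normal_density) (simp_all add: var_rate_def)
    ultimately show "(\<lambda>n. char (distr M borel (\<lambda>\<omega>. (real (Z n \<omega>) - 57 / 700 * real n) / sqrt (real n))) s)
      \<longlonglongrightarrow> char (density lborel (normal_density 0 (sqrt (1692302314867 / 43692253605000)))) s"
      using prot_char_limit by (simp only:)
  qed
qed

end
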